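(* Let $(K,I,J,g,q,k)$ be a finite two-player zero-sum stochastic game with $K=\{1,\dots,n\}$ and initial state $k\in K$. For $\lambda\in(0,1]$ and $z\in\mathbb{R}$, let $W^k_\lambda(z)$ be the $|I|^n\times|J|^n$ real matrix with entries $W^k_\lambda(z)[\mathbf{i},\mathbf{j}]=d^k_\lambda(\mathbf{i},\mathbf{j})-z\,d^0_\lambda(\mathbf{i},\mathbf{j})$ for $(\mathbf{i},\mathbf{j})\in I^n\times J^n$. Then for any $z\in\mathbb{R}$ the limit $$F^k(z):=\lim_{\lambda\to0}\frac{\mathrm{val}\,W^k_\lambda(z)}{\lambda^n}$$ exists in $\mathbb{R}\cup\{\pm\infty\}$. Moreover, the value $v^k$ of the stochastic game $(K,I,J,g,q,k)$ is the unique $w\in\mathbb{R}$ such that, for all $z\in\mathbb{R}$, $$z>w\ \Rightarrow\ F^k(z)<0\qquad\text{and}\qquad z<w\ \Rightarrow\ F^k(z)>0.$$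
   Context: For a finite set $E$, $\Delta(E)$ is the set of probability distributions on $E$. The value $\mathrm{val}\,M$ of a real $p\times q$ matrix $M=(m_{a,b})$ is the minmax value $\max_{s}\min_{t}\sum_{a,b}s(a)m_{a,b}t(b)=\min_t\max_s\sum_{a,b}s(a)m_{a,b}t(b)$, with $s\in\Delta(\{1,\dots,p\})$, $t\in\Delta(\{1,\dots,q\})$. Stochastic game $(K,I,J,g,q,k)$: $K=\{1,\dots,n\}$ is a finite set of states ($n\geq1$), $I,J$ are finite nonempty action sets of Players 1 and 2, $g:K\times I\times J\to\mathbb{R}$ is the reward function (to Player 1), $q:K\times I\times J\to\Delta(K)$ is the transition function (write $q(\ell'\mid\ell,i,j)$ for the probability of moving to $\ell'$), and $k\in K$ is the initial state. Play: $k_1=k$; at each stage $m\ge1$, knowing the current state $k_m$ and the past states and actions, the players independently and simultaneously choose $i_m\in I$ and $j_m\in J$; these are observed, and $k_{m+1}$ is drawn from $q(k_m,i_m,j_m)$. A strategy of Player 1 is a sequence $\sigma=(\sigma_m)_{m\ge1}$ of maps $\sigma_m:(K\times I\times J)^{m-1}\times K\to\Delta(I)$; a strategy of Player 2 is a sequence $\tau=(\tau_m)_{m\ge 1}$ of maps $\tau_m:(K\times I\times J)^{m-1}\times K\to\Delta(J)$. The sets of strategies are $\Sigma$ and $\mathcal{T}$. A pair $(\sigma,\tau)$ and $k$ induce a probability on plays $(K\times I\times J)^{\mathbb{N}}$, with expectation $\mathbb{E}^k_{\sigma,\tau}$. Value: the game $(K,I,J,g,q,k)$ has value $v^k\in\mathbb{R}$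 if for every $\varepsilon>0$ there exists $M_0$ such that Player 1 has a strategy guaranteeing, against every strategy of Player 2, that for all $M_0\le M\le+\infty$ the expectation of the average reward per stage $\frac1M\sum_{m=1}^M g(k_m,i_m,j_m)$ over the first $M$ stages is at least $v^k-\varepsilon$, and Player 2 has a strategy guaranteeing, against every strategy of Player 1, that for all $M_0\le M\le+\infty$ this amount is at most $v^k+\varepsilon$ (for $M=+\infty$ the average is understood as the $\liminf$ of the finite averages in Player 1's guarantee and as the $\limsup$ in Player 2's). By a theorem of Mertens and Neyman every such game has a (unique) value $v^k$, and $v^k=\lim_{\lambda\to0}v^k_\lambda$, where, for $\lambda\in(0,1]$, $v^k_\lambda=\sup_{\sigma\in\Sigma}\inf_{\tau\in\mathcal{T}}\gamma^k_\lambda(\sigma,\tau)=\inf_{\tau\in\mathcal{T}}\sup_{\sigma\in\Sigma}\gamma^k_\lambda(\sigma,\tau)$ is the value of the $\lambda$-discounted game with payoff $\gamma^k_\lambda(\sigma,\tau)=\mathbb{E}^k_{\sigma,\tau}\big[\sum_{m\ge1}\lambda(1-\lambda)^{m-1}g(k_m,i_m,j_m)\big]$. Elements $\mathbf{i}=(\mathbf{i}^1,\dots,\mathbf{i}^n)\in I^n$ and $\mathbf{j}=(\mathbf{j}^1,\dots,\mathbf{j}^n)\in J^n$ are pure stationary strategies (play $\mathbf{i}^\ell$, resp. $\mathbf{j}^\ell$, in state $\ell$). Let $Q(\mathbf{i},\mathbf{j})\in\mathbb{R}^{n\times n}$ have entries $Q^{\ell,\ell'}(\mathbf{i},\mathbf{j})=q(\ell'\mid\ell,\mathbf{i}^\ell,\mathbf{j}^\ell)$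 and let $g(\mathbf{i},\mathbf{j})\in\mathbb{R}^n$ have entries $g^\ell(\mathbf{i},\mathbf{j})=g(\ell,\mathbf{i}^\ell,\mathbf{j}^\ell)$. Define $d^0_\lambda(\mathbf{i},\mathbf{j})=\det(\mathrm{Id}-(1-\lambda)Q(\mathbf{i},\mathbf{j}))$, and let $d^k_\lambda(\mathbf{i},\mathbf{j})$ be the determinant of the $n\times n$ matrix obtained by replacing the $k$-th column of $\mathrm{Id}-(1-\lambda)Q(\mathbf{i},\mathbf{j})$ with $\lambda g(\mathbf{i},\mathbf{j})$. *)

theory Defs
  imports "HOL-Probability.Probability"
begin

section \<open>Values of matrix games\<close>

text \<open>
  The infimum and the supremum below are attained (the payoff is bilinear on a product of
  simplices), so this is the usual max-min value.
\<close>

definition matrix_val :: "real ^ 'b ^ 'a \<Rightarrow> real" where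
  "matrix_val M =
     (SUP s :: 'a pmf. INF t :: 'b pmf. \<Sum>a\<in>UNIV. \<Sum>b\<in>UNIV. pmf s a * M $ a $ b * pmf t b)"


section \<open>Stochastic games\<close>

text \<open>
  The state set is a finite type, and the action sets are finite types as well; the number of
  states is \<open>CARD('k)\<close>. A game is given by a reward function \<open>g\<close>, a transition
  function \<open>q\<close> and an initial state \<open>k\<close>.
\<close>

type_synonym ('k, 'i, 'j) reward = "'k \<Rightarrow> 'i \<Rightarrow> 'j \<Rightarrow> real"
type_synonym ('k, 'i, 'j) transition = "'k \<Rightarrow> 'i \<Rightarrow> 'j \<Rightarrow> 'k pmf"

text \<open>
  A strategy maps the list of past (state, action, action) triples, in chronological order, and
  the current state to a mixed action. Its component for stage \<open>m\<close> is its restriction to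
  lists of length \<open>m - 1\<close>.
\<close>

type_synonym ('k, 'i, 'j) strategy1 = "('k \<times> 'i \<times> 'j) list \<Rightarrow> 'k \<Rightarrow> 'i pmf"
type_synonym ('k, 'i, 'j) strategy2 = "('k \<times> 'i \<times> 'j) list \<Rightarrow> 'k \<Rightarrow> 'j pmf"

text \<open>
  A play is a sequence \<open>\<omega> :: nat \<Rightarrow> 'k \<times> 'i \<times> 'j\<close>. Stages are numbered from
  \<open>0\<close>, so \<open>\<omega> m\<close> is the triple of stage \<open>m + 1\<close>.
\<close>

fun state_pmf :: "('k, 'i, 'j) transition \<Rightarrow> 'k \<Rightarrow> nat \<Rightarrow> (nat \<Rightarrow> 'k \<times> 'i \<times> 'j) \<Rightarrow> 'k pmf" where
  "state_pmf q k 0 \<omega> = return_pmf k"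
| "state_pmf q k (Suc m) \<omega> = (case \<omega> m of (l, i, j) \<Rightarrow> q l i j)"

definition stage_pmf ::
  "('k, 'i, 'j) transition \<Rightarrow> 'k \<Rightarrow> ('k, 'i, 'j) strategy1 \<Rightarrow> ('k, 'i, 'j) strategy2 \<Rightarrow>
   nat \<Rightarrow> (nat \<Rightarrow> 'k \<times> 'i \<times> 'j) \<Rightarrow> ('k \<times> 'i \<times> 'j) pmf" where
  "stage_pmf q k \<sigma> \<tau> m \<omega> =
     bind_pmf (state_pmf q k m \<omega>) (\<lambda>l.
       map_pmf (Pair l) (pair_pmf (\<sigma> (map \<omega> [0..<m]) l) (\<tau> (map \<omega> [0..<m]) l)))"

text \<open>
  The law of the play is the infinite-horizon measure that the Ionescu-Tulcea theorem yields for
  the kernels \<open>stage_pmf\<close>.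
\<close>

definition play_measure ::
  "('k, 'i, 'j) transition \<Rightarrow> 'k \<Rightarrow> ('k, 'i, 'j) strategy1 \<Rightarrow> ('k, 'i, 'j) strategy2 \<Rightarrow>
   (nat \<Rightarrow> 'k \<times> 'i \<times> 'j) measure" where
  "play_measure q k \<sigma> \<tau> =
     projective_family.lim UNIV
       (Ionescu_Tulcea.CI (\<lambda>m \<omega>. measure_pmf (stage_pmf q k \<sigma> \<tau> m \<omega>)) (\<lambda>_. count_space UNIV))
       (\<lambda>_. count_space UNIV)"

lemma state_pmf_cong:
  assumes "\<And>n. n < m \<Longrightarrow> \<omega> n = \<omega>' n"
  shows "state_pmf q k m \<omega> = state_pmf q k m \<omega>'"
  using assms by (cases m) auto

lemma stage_pmf_cong:
  assumes "\<And>n. n < m \<Longrightarrow> \<omega> n = \<omega>' n"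
  shows "stage_pmf q k \<sigma> \<tau> m \<omega> = stage_pmf q k \<sigma> \<tau> m \<omega>'"
proof -
  have "map \<omega> [0..<m] = map \<omega>' [0..<m]"
    using assms by auto
  then show ?thesis
    unfolding stage_pmf_def by (simp only: state_pmf_cong[OF assms])
qed

lemma Ionescu_Tulcea_stage:
  fixes q :: "('k::finite, 'i::finite, 'j::finite) transition"
  shows "Ionescu_Tulcea (\<lambda>m \<omega>. measure_pmf (stage_pmf q k \<sigma> \<tau> m \<omega>)) (\<lambda>_. count_space UNIV)"
proof
  fix m :: nat
  have "PiM {0..<m} (\<lambda>_. count_space (UNIV :: ('k \<times> 'i \<times> 'j) set)) =
      count_space ({0..<m} \<rightarrow>\<^sub>E UNIV)"
    by (rule count_space_PiM_finite) auto
  then show "(\<lambda>\<omega>. measure_pmf (stage_pmf q k \<sigma> \<tau> m \<omega>)) \<in>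
      PiM {0..<m} (\<lambda>_. count_space UNIV) \<rightarrow>\<^sub>M subprob_algebra (count_space UNIV)"
    by (auto simp: measure_pmf_in_subprob_algebra)
qed

lemma prob_space_play_measure:
  fixes q :: "('k::finite, 'i::finite, 'j::finite) transition"
  shows "prob_space (play_measure q k \<sigma> \<tau>)"
proof -
  interpret Ionescu_Tulcea "\<lambda>m \<omega>. measure_pmf (stage_pmf q k \<sigma> \<tau> m \<omega>)" "\<lambda>_. count_space UNIV"
    by (rule Ionescu_Tulcea_stage)
  show ?thesis
    unfolding play_measure_def
  proof
    have [simp]: "PF.emb UNIV {} {\<lambda>x. undefined} = space PF.lim"
      by (auto simp: prod_emb_def space_PiM)
    have "emeasure PF.lim (PF.emb UNIV {} {\<lambda>x. undefined}) = emeasure (CI {}) {\<lambda>x. undefined}"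
      by (rule lim) (auto simp: PiM_empty)
    also have "\<dots> = 1"
      using prob_space.emeasure_space_1[OF PF.prob_space_P, of "{}"]
      by (simp add: PF.space_P space_PiM)
    finally show "emeasure PF.lim (space PF.lim) = 1"
      by simp
  qed
qed

text \<open>
  Since \<open>g\<close> takes finitely many values, the averages are bounded. Hence the limits inferior and
  superior below are finite and \<open>real_of_ereal\<close> loses no information.
\<close>

definition stage_reward :: "('k, 'i, 'j) reward \<Rightarrow> (nat \<Rightarrow> 'k \<times> 'i \<times> 'j) \<Rightarrow> nat \<Rightarrow> real" where
  "stage_reward g \<omega> m = (case \<omega> m of (l, i, j) \<Rightarrow> g l i j)"

definition avg_reward :: "('k, 'i, 'j) reward \<Rightarrow> nat \<Rightarrow> (nat \<Rightarrow> 'k \<times> 'i \<times> 'j) \<Rightarrow> real" where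
  "avg_reward g M \<omega> = (\<Sum>m<M. stage_reward g \<omega> m) / real M"

definition liminf_reward :: "('k, 'i, 'j) reward \<Rightarrow> (nat \<Rightarrow> 'k \<times> 'i \<times> 'j) \<Rightarrow> real" where
  "liminf_reward g \<omega> = real_of_ereal (liminf (\<lambda>M. ereal (avg_reward g M \<omega>)))"

definition limsup_reward :: "('k, 'i, 'j) reward \<Rightarrow> (nat \<Rightarrow> 'k \<times> 'i \<times> 'j) \<Rightarrow> real" where
  "limsup_reward g \<omega> = real_of_ereal (limsup (\<lambda>M. ereal (avg_reward g M \<omega>)))"

text \<open>
  In \<open>is_game_value\<close>, the guarantees through \<open>liminf_reward\<close> and \<open>limsup_reward\<close> are those
  for an infinite number of stages. A value is unique by \<open>is_game_value_unique\<close> below; that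
  every finite game has one is the theorem of Mertens and Neyman, which is not proved here.
\<close>

definition is_game_value ::
  "('k, 'i, 'j) reward \<Rightarrow> ('k, 'i, 'j) transition \<Rightarrow> 'k \<Rightarrow> real \<Rightarrow> bool" where
  "is_game_value g q k v \<longleftrightarrow>
     (\<forall>\<epsilon>>0. \<exists>M\<^sub>0\<ge>1.
        (\<exists>\<sigma>. \<forall>\<tau>.
           (\<forall>M\<ge>M\<^sub>0. v - \<epsilon> \<le> (\<integral>\<omega>. avg_reward g M \<omega> \<partial>play_measure q k \<sigma> \<tau>)) \<and>
           v - \<epsilon> \<le> (\<integral>\<omega>. liminf_reward g \<omega> \<partial>play_measure q k \<sigma> \<tau>)) \<and>
        (\<exists>\<tau>. \<forall>\<sigma>.
           (\<forall>M\<ge>M\<^sub>0. (\<integral>\<omega>. avg_reward g M \<omega> \<partial>play_measure q k \<sigma> \<tau>) \<le> v + \<epsilon>) \<and>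
           (\<integral>\<omega>. limsup_reward g \<omega> \<partial>play_measure q k \<sigma> \<tau>) \<le> v + \<epsilon>))"

lemma is_game_value_le:
  assumes v: "is_game_value g q k v" and w: "is_game_value g q k w"
  shows "v \<le> w"
proof (rule field_le_epsilon)
  fix e :: real
  assume "e > 0"
  then have e: "e / 2 > 0" by simp
  let ?P = "play_measure q k"
  obtain M \<sigma> where \<sigma>: "\<forall>\<tau>. (\<forall>N\<ge>M. v - e / 2 \<le> (\<integral>\<omega>. avg_reward g N \<omega> \<partial>?P \<sigma> \<tau>)) \<and>
      v - e / 2 \<le> (\<integral>\<omega>. liminf_reward g \<omega> \<partial>?P \<sigma> \<tau>)"
    using v[unfolded is_game_value_def, rule_format, OF e] by (elim exE conjE)
  obtain M' \<tau> where \<tau>: "\<forall>\<sigma>. (\<forall>N\<ge>M'. (\<integral>\<omega>. avg_reward g N \<omega> \<partial>?P \<sigma> \<tau>) \<le> w + e / 2) \<and>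
      (\<integral>\<omega>. limsup_reward g \<omega> \<partial>?P \<sigma> \<tau>) \<le> w + e / 2"
    using w[unfolded is_game_value_def, rule_format, OF e] by (elim exE conjE)
  have "v - e / 2 \<le> (\<integral>\<omega>. avg_reward g (max M M') \<omega> \<partial>?P \<sigma> \<tau>)"
    using \<sigma> by (meson max.cobounded1)
  also have "\<dots> \<le> w + e / 2"
    using \<tau> by (meson max.cobounded2)
  finally show "v \<le> w + e"
    by simp
qed

lemma is_game_value_unique:
  "is_game_value g q k v \<Longrightarrow> is_game_value g q k w \<Longrightarrow> v = w"
  by (simp add: is_game_value_le order.antisym)


section \<open>The auxiliary matrix game\<close>

text \<open>A pure stationary strategy is a function from states to actions.\<close>

definition trans_mat ::
  "('k, 'i, 'j) transition \<Rightarrow> ('k \<Rightarrow> 'i) \<Rightarrow> ('k \<Rightarrow> 'j) \<Rightarrow> real ^ 'k ^ 'k" where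
  "trans_mat q i j = (\<chi> l l'. pmf (q l (i l) (j l)) l')"

definition reward_vec ::
  "('k, 'i, 'j) reward \<Rightarrow> ('k \<Rightarrow> 'i) \<Rightarrow> ('k \<Rightarrow> 'j) \<Rightarrow> real ^ 'k" where
  "reward_vec g i j = (\<chi> l. g l (i l) (j l))"

definition replace_column :: "'k \<Rightarrow> real ^ 'k ^ 'k \<Rightarrow> real ^ 'k \<Rightarrow> real ^ 'k ^ 'k" where
  "replace_column k A b = (\<chi> l l'. if l' = k then b $ l else A $ l $ l')"

definition disc_mat ::
  "('k, 'i, 'j) transition \<Rightarrow> real \<Rightarrow> ('k \<Rightarrow> 'i) \<Rightarrow> ('k \<Rightarrow> 'j) \<Rightarrow> real ^ 'k ^ 'k" where
  "disc_mat q lam i j = mat 1 - (1 - lam) *\<^sub>R trans_mat q i j"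

definition det0 ::
  "('k::finite, 'i, 'j) transition \<Rightarrow> real \<Rightarrow> ('k \<Rightarrow> 'i) \<Rightarrow> ('k \<Rightarrow> 'j) \<Rightarrow> real" where
  "det0 q lam i j = det (disc_mat q lam i j)"

definition detk ::
  "('k::finite, 'i, 'j) reward \<Rightarrow> ('k, 'i, 'j) transition \<Rightarrow> 'k \<Rightarrow> real \<Rightarrow>
   ('k \<Rightarrow> 'i) \<Rightarrow> ('k \<Rightarrow> 'j) \<Rightarrow> real" where
  "detk g q k lam i j = det (replace_column k (disc_mat q lam i j) (lam *\<^sub>R reward_vec g i j))"

definition W ::
  "('k::finite, 'i::finite, 'j::finite) reward \<Rightarrow> ('k, 'i, 'j) transition \<Rightarrow> 'k \<Rightarrow> real \<Rightarrow> real \<Rightarrow>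
   real ^ ('k \<Rightarrow> 'j) ^ ('k \<Rightarrow> 'i)" where
  "W g q k lam z = (\<chi> i j. detk g q k lam i j - z * det0 q lam i j)"

definition W_quot ::
  "('k::finite, 'i::finite, 'j::finite) reward \<Rightarrow> ('k, 'i, 'j) transition \<Rightarrow> 'k \<Rightarrow> real \<Rightarrow> real \<Rightarrow>
   ereal" where
  "W_quot g q k z lam = ereal (matrix_val (W g q k lam z) / lam ^ CARD('k))"

definition F ::
  "('k::finite, 'i::finite, 'j::finite) reward \<Rightarrow> ('k, 'i, 'j) transition \<Rightarrow> 'k \<Rightarrow> real \<Rightarrow> ereal" where
  "F g q k z = Lim (at_right 0) (W_quot g q k z)"

end

theory Submission
  imports Defs
begin

text \<open>
  Whether the value of a matrix game with polynomial entries exceeds a given polynomial is a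
  question of feasibility of a strict linear system; Fourier--Motzkin elimination only multiplies
  and adds the coefficients, so the answer is eventually constant as \<open>\<lambda>\<close> tends to \<open>0\<close>. This
  yields the existence of \<open>F z\<close>.

  Since \<open>det0 \<ge> \<lambda> ^ n\<close>, the function \<open>F\<close> decreases at least with slope \<open>- 1\<close>, and it changes sign
  between the bounds of the reward, which yields the unique \<open>w\<close>.

  If \<open>u\<close> is the vector of values of the discounted game, then by Cramer's rule and the
  multilinearity of determinants in their rows the products of the local optimal actions guarantee
  \<open>0\<close> in the matrix game \<open>W\<close> at \<open>z = u k\<close>. A player who guarantees \<open>v\<close> up to \<open>\<epsilon>\<close> in all long
  averages also does so in the discounted game for small \<open>\<lambda>\<close> (summation by parts), so \<open>u k\<close>
  tends to \<open>v\<close>, and the sign change of \<open>F\<close> is at \<open>v\<close>.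
\<close>


section \<open>Semialgebraic limits of matrix game values\<close>

text \<open>The power of \<open>lam\<close> is the least value that \<open>det0\<close> can take: it
  is attained when every state is absorbing. Dividing by it makes the slope bound independent of
  \<open>lam\<close>, so the bound survives the limit, and a weak sign of \<open>F\<close> at a
  nearby point becomes a strict sign. Hence weak signs of the matrix value at \<open>u k\<close>
  suffice, and each comes from one player's mixture alone. Multilinearity applies because row
  \<open>l\<close> of \<open>Id - (1 - lam) Q(i, j)\<close> involves only the actions chosen in
  state \<open>l\<close>, and replacing column \<open>k\<close> preserves this. A product mixture of
  pure stationary strategies therefore averages both determinants to those of the mixed stationary
  strategy. Elimination works on homogeneous strict inequalities, whereas a mixed action satisfies
  weak inequalities and a normalisation. This is why \<open>matrix_val M > c\<close> is rephrased
  with strictly positive weights of arbitrary total. The point \<open>w\<close> is constructed from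
  \<open>F\<close> alone; a game value enters only as the hypothesis under which \<open>w\<close> is
  identified.\<close>

lemma real_polynomial_sign_at_right:
  fixes f :: "real \<Rightarrow> real"
  assumes f: "real_polynomial_function f"
  shows "(\<forall>\<^sub>F x in at_right 0. f x < 0) \<or> (\<forall>\<^sub>F x in at_right 0. f x = 0) \<or>
    (\<forall>\<^sub>F x in at_right 0. f x > 0)"
proof (cases "\<forall>x. f x = 0")
  case False
  obtain a n where a: "f = (\<lambda>x. \<Sum>i\<le>n. a i * x ^ i)"
    using f by (auto simp: real_polynomial_function_iff_sum)
  have "finite {x. f x = 0}"
  proof -
    have "\<exists>i\<le>n. a i \<noteq> 0"
      using False by (auto simp: a) (metis (mono_tags, lifting) atMost_iff mult_zero_left sum.neutral)
    then show ?thesis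
      unfolding a using polyfun_finite_roots[of a n] by auto
  qed
  \<comment> \<open>The extra point \<open>1\<close> keeps the set nonempty when there is no
    positive root, so that its minimum exists.\<close>
  then have fin: "finite ({x. f x = 0 \<and> x > 0} \<union> {1})"
    using finite_subset[of "{x. f x = 0 \<and> x > 0}" "{x. f x = 0}"] by auto
  define d where "d = Min ({x. f x = 0 \<and> x > 0} \<union> {1})"
  have d: "d > 0"
    unfolding d_def using fin by (subst Min_gr_iff) auto
  have nz: "f x \<noteq> 0" if "x \<in> {0<..<d}" for x
    using that Min_le[OF fin, of x] by (auto simp: d_def)
  have "connected (f ` {0<..<d})"
    by (intro connected_continuous_image continuous_at_imp_continuous_on ballI
        continuous_real_polymonial_function f) auto
  then have "(\<forall>x\<in>{0<..<d}. f x < 0) \<or> (\<forall>x\<in>{0<..<d}. f x > 0)"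
  proof (rule contrapos_pp)
    assume "\<not> ((\<forall>x\<in>{0<..<d}. f x < 0) \<or> (\<forall>x\<in>{0<..<d}. f x > 0))"
    then obtain x y where "x \<in> {0<..<d}" "f x \<ge> 0" "y \<in> {0<..<d}" "f y \<le> 0"
      by (auto simp: not_less)
    moreover from this have "0 \<in> f ` {0<..<d}" if "connected (f ` {0<..<d})"
      using connectedD_interval[OF that, of "f y" "f x" 0] by blast
    ultimately show "\<not> connected (f ` {0<..<d})"
      using nz by auto
  qed
  moreover have "\<forall>\<^sub>F x in at_right 0. x \<in> {0<..<d}"
    using d by (rule eventually_at_right_real)
  ultimately have "(\<forall>\<^sub>F x in at_right 0. f x < 0) \<or> (\<forall>\<^sub>F x in at_right 0. f x > 0)"
    by (metis (mono_tags, lifting) eventually_mono)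
  then show ?thesis by blast
qed auto

text \<open>This chooses the eliminated variable between its lower and upper bounds. Either family
  of bounds may be empty, hence the order without end points.\<close>

lemma finite_sets_between:
  fixes L U :: "'a::{dense_linorder, no_top, no_bot} set"
  assumes "finite L" "finite U" "\<And>a b. a \<in> L \<Longrightarrow> b \<in> U \<Longrightarrow> a < b"
  shows "\<exists>c. (\<forall>a\<in>L. a < c) \<and> (\<forall>b\<in>U. c < b)"
proof (cases "L = {} \<or> U = {}")
  case True
  then show ?thesis
    using assms(1,2) gt_ex[of "Max L"] lt_ex[of "Min U"] by (cases "L = {}"; cases "U = {}") auto
next
  case False
  then have "Max L < Min U" using assms by simp
  then obtain c where "Max L < c" "c < Min U" using dense by blast
  then show ?thesis using False assms(1,2) by auto
qed

text \<open>Eliminating a variable from strict homogeneous inequalities gives inequalities of the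
  same kind whose coefficients are again polynomials, so the induction closes. With no variables
  left the system is feasible exactly if it has no rows, whatever \<open>t\<close> is.\<close>

lemma fourier_motzkin_at_right:
  fixes R :: "('v \<Rightarrow> real \<Rightarrow> real) set"
  assumes "finite V" "finite R" "\<And>r v. r \<in> R \<Longrightarrow> real_polynomial_function (r v)"
  shows "(\<forall>\<^sub>F t in at_right 0. \<exists>x. \<forall>r\<in>R. (\<Sum>v\<in>V. r v t * x v) > 0) \<or>
    (\<forall>\<^sub>F t in at_right 0. \<not> (\<exists>x. \<forall>r\<in>R. (\<Sum>v\<in>V. r v t * x v) > 0))"
  using assms
proof (induction V arbitrary: R rule: finite_induct)
  case empty
  then show ?case by auto
next
  case (insert w V)
  \<comment> \<open>Rows are sorted by the eventual sign of their coefficient rather than by its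
    sign at a given \<open>t\<close>, so the eliminated system \<open>R'\<close> is one family of
    polynomial rows for all small \<open>t\<close>.\<close>
  define P where "P = {r\<in>R. \<forall>\<^sub>F t in at_right 0. r w t > 0}"
  define N where "N = {r\<in>R. \<forall>\<^sub>F t in at_right 0. r w t < 0}"
  define Z where "Z = {r\<in>R. \<forall>\<^sub>F t in at_right 0. r w t = 0}"
  \<comment> \<open>For \<open>r\<close> in \<open>P\<close> and \<open>r'\<close> in
    \<open>N\<close> both multipliers are eventually positive, and the coefficient of
    \<open>w\<close> cancels.\<close>
  define comb where "comb r r' = (\<lambda>v t. r v t * (- r' w t) + r' v t * r w t)"
    for r r' :: "'v \<Rightarrow> real \<Rightarrow> real"
  define R' where "R' = Z \<union> case_prod comb ` (P \<times> N)"
  have fin: "finite P" "finite N" "finite Z"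
    using insert.prems(1) by (auto simp: P_def N_def Z_def)
  have R_eq: "R = P \<union> N \<union> Z"
    using real_polynomial_sign_at_right[OF insert.prems(2)] unfolding P_def N_def Z_def by blast
  have P: "\<forall>\<^sub>F t in at_right 0. \<forall>r\<in>P. r w t > 0" and N: "\<forall>\<^sub>F t in at_right 0. \<forall>r\<in>N. r w t < 0"
    and Z: "\<forall>\<^sub>F t in at_right 0. \<forall>r\<in>Z. r w t = 0"
    by (rule eventually_ball_finite, use fin in simp, simp add: P_def N_def Z_def)+
  have equiv: "\<forall>\<^sub>F t in at_right 0. (\<exists>x. \<forall>r\<in>R. (\<Sum>v\<in>insert w V. r v t * x v) > 0) \<longleftrightarrow>
      (\<exists>x. \<forall>r\<in>R'. (\<Sum>v\<in>V. r v t * x v) > 0)"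
    using P N Z
  proof eventually_elim
    case (elim t)
    have comb: "(\<Sum>v\<in>V. comb r r' v t * x v) =
        (\<Sum>v\<in>V. r v t * x v) * (- r' w t) + (\<Sum>v\<in>V. r' v t * x v) * r w t" for r r' x
      unfolding sum_distrib_right sum.distrib[symmetric]
      by (intro sum.cong) (auto simp: comb_def algebra_simps)
    show ?case
    proof
      assume "\<exists>x. \<forall>r\<in>R. (\<Sum>v\<in>insert w V. r v t * x v) > 0"
      then obtain x where x: "\<And>r. r \<in> R \<Longrightarrow> r w t * x w + (\<Sum>v\<in>V. r v t * x v) > 0"
        using insert.hyps by auto
      have "(\<Sum>v\<in>V. r v t * x v) > 0" if "r \<in> R'" for r
        using that unfolding R'_def
      proof
        assume "r \<in> Z"
        then show ?thesis
          using x[of r] elim R_eq by auto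
      next
        assume "r \<in> case_prod comb ` (P \<times> N)"
        then obtain p n where pn: "p \<in> P" "n \<in> N" and r: "r = comb p n"
          by auto
        have "(p w t * x w + (\<Sum>v\<in>V. p v t * x v)) * (- n w t) +
            (n w t * x w + (\<Sum>v\<in>V. n v t * x v)) * p w t > 0"
          by (rule add_pos_pos; rule mult_pos_pos) (use x[of p] x[of n] pn elim R_eq in auto)
        then show ?thesis
          unfolding r comb by (simp add: algebra_simps)
      qed
      then show "\<exists>x. \<forall>r\<in>R'. (\<Sum>v\<in>V. r v t * x v) > 0" by blast
    next
      assume "\<exists>x. \<forall>r\<in>R'. (\<Sum>v\<in>V. r v t * x v) > 0"
      then obtain x where x: "\<And>r. r \<in> R' \<Longrightarrow> (\<Sum>v\<in>V. r v t * x v) > 0" by blast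
      \<comment> \<open>Solved for the variable \<open>w\<close>, the rows in \<open>P\<close> are
        lower bounds and those in \<open>N\<close> upper bounds.\<close>
      define L where "L = (\<lambda>r. - (\<Sum>v\<in>V. r v t * x v) / r w t) ` P"
      define U where "U = (\<lambda>r. - (\<Sum>v\<in>V. r v t * x v) / r w t) ` N"
      have "a < b" if ab: "a \<in> L" "b \<in> U" for a b
      proof -
        obtain p n where pn: "p \<in> P" "n \<in> N" and a: "a = - (\<Sum>v\<in>V. p v t * x v) / p w t"
          and b: "b = - (\<Sum>v\<in>V. n v t * x v) / n w t"
          using ab unfolding L_def U_def by blast
        have pos: "p w t > 0" "n w t < 0" using elim pn by auto
        have "(\<Sum>v\<in>V. p v t * x v) * (- n w t) + (\<Sum>v\<in>V. n v t * x v) * p w t > 0"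
          using x[of "comb p n"] pn unfolding R'_def comb by auto
        then show ?thesis
          unfolding a b using pos by (simp add: field_simps)
      qed
      moreover have "finite L" "finite U" using fin by (auto simp: L_def U_def)
      ultimately obtain c where c: "\<And>a. a \<in> L \<Longrightarrow> a < c" "\<And>b. b \<in> U \<Longrightarrow> c < b"
        using finite_sets_between[of L U] by metis
      have "r w t * c + (\<Sum>v\<in>V. r v t * x v) > 0" if r: "r \<in> R" for r
      proof -
        consider "r \<in> P" | "r \<in> N" | "r \<in> Z" using r R_eq by blast
        then show ?thesis
        proof cases
          case 1
          then show ?thesis
            using c(1)[of "- (\<Sum>v\<in>V. r v t * x v) / r w t"] elim by (auto simp: L_def field_simps)
        next
          case 2
          then show ?thesis
            using c(2)[of "- (\<Sum>v\<in>V. r v t * x v) / r w t"] elim by (auto simp: U_def field_simps)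
        next
          case 3
          then have "r w t = 0" using elim by blast
          then show ?thesis using 3 x[of r] by (simp add: R'_def)
        qed
      qed
      moreover have "(\<Sum>v\<in>V. r v t * (x(w := c)) v) = (\<Sum>v\<in>V. r v t * x v)" for r
        using insert.hyps by (intro sum.cong) auto
      ultimately show "\<exists>x. \<forall>r\<in>R. (\<Sum>v\<in>insert w V. r v t * x v) > 0"
        using insert.hyps by (intro exI[of _ "x(w := c)"]) simp
    qed
  qed
  have "real_polynomial_function (comb r r' v)" if "r \<in> R" "r' \<in> R" for r r' v
    unfolding comb_def using that
    by (intro real_polynomial_function.intros(3,4) real_polynomial_function_minus insert.prems(2))
  then have "real_polynomial_function (r v)" if "r \<in> R'" for r v
    using that insert.prems(2) unfolding R'_def P_def N_def Z_def by auto
  moreover have "finite R'" using fin by (auto simp: R'_def)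
  ultimately consider "\<forall>\<^sub>F t in at_right 0. \<exists>x. \<forall>r\<in>R'. (\<Sum>v\<in>V. r v t * x v) > 0"
    | "\<forall>\<^sub>F t in at_right 0. \<not> (\<exists>x. \<forall>r\<in>R'. (\<Sum>v\<in>V. r v t * x v) > 0)"
    using insert.IH[of R'] by blast
  then show ?case
  proof cases
    case 1
    with equiv have "\<forall>\<^sub>F t in at_right 0. \<exists>x. \<forall>r\<in>R. (\<Sum>v\<in>insert w V. r v t * x v) > 0"
      by eventually_elim blast
    then show ?thesis by blast
  next
    case 2
    with equiv have "\<forall>\<^sub>F t in at_right 0. \<not> (\<exists>x. \<forall>r\<in>R. (\<Sum>v\<in>insert w V. r v t * x v) > 0)"
      by eventually_elim blast
    then show ?thesis by blast
  qed
qed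

text \<open>The limit is the supremum of the levels that are eventually exceeded. A level above it
  is not eventually exceeded, hence by assumption eventually not exceeded. Infinite limits arise
  when no level or every level is exceeded.\<close>

lemma tendsto_ereal_if_eventually_decided:
  fixes f :: "'a \<Rightarrow> real"
  assumes "\<And>c. (\<forall>\<^sub>F x in G. f x > c) \<or> (\<forall>\<^sub>F x in G. \<not> f x > c)"
  shows "\<exists>L::ereal. ((\<lambda>x. ereal (f x)) \<longlongrightarrow> L) G"
proof
  let ?L = "Sup {ereal c | c. \<forall>\<^sub>F x in G. f x > c}"
  show "((\<lambda>x. ereal (f x)) \<longlongrightarrow> ?L) G"
  proof (rule order_tendstoI)
    fix a assume "a < ?L"
    then obtain c where c: "a < ereal c" "\<forall>\<^sub>F x in G. f x > c"
      by (auto simp: less_Sup_iff)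
    from c(2) show "\<forall>\<^sub>F x in G. a < ereal (f x)"
      by eventually_elim (use c(1) in \<open>auto intro: less_trans\<close>)
  next
    fix a assume "?L < a"
    then obtain c where c: "?L < ereal c" "ereal c < a"
      using ereal_dense2 by blast
    have "\<not> (\<forall>\<^sub>F x in G. f x > c)"
      using c(1) Sup_upper[of "ereal c" "{ereal c | c. \<forall>\<^sub>F x in G. f x > c}"] by auto
    then have "\<forall>\<^sub>F x in G. \<not> f x > c" using assms by blast
    then show "\<forall>\<^sub>F x in G. ereal (f x) < a"
    proof eventually_elim
      case (elim x)
      then have "ereal (f x) \<le> ereal c" by simp
      then show ?case using c(2) by (rule le_less_trans)
    qed
  qed
qed

section \<open>Values of matrix games as strict linear systems\<close>

lemma sum_pmf_UNIV [simp]: "(\<Sum>a\<in>UNIV. pmf (s :: 'a::finite pmf) a) = 1"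
  by (rule sum_pmf_eq_1) auto

lemma sum_pmf_mult_const: "(\<Sum>a\<in>UNIV. pmf (s :: 'a::finite pmf) a * c) = c"
  by (simp flip: sum_distrib_right)

lemma obtain_pmf:
  fixes f :: "'a::finite \<Rightarrow> real"
  assumes "\<And>a. f a \<ge> 0" "(\<Sum>a\<in>UNIV. f a) = 1"
  obtains s where "\<And>a. pmf s a = f a"
proof
  have "(\<integral>\<^sup>+ a. ennreal (f a) \<partial>count_space UNIV) = 1"
    using assms by (simp add: nn_integral_count_space_finite sum_ennreal)
  then show "pmf (embed_pmf f) a = f a" for a
    using assms(1) by (intro pmf_embed_pmf) auto
qed

context
  fixes M :: "real ^ 'b::finite ^ 'a::finite"
begin

private abbreviation "pay s t \<equiv> \<Sum>a\<in>UNIV. \<Sum>b\<in>UNIV. pmf s a * M $ a $ b * pmf t b"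

lemma pay_swap: "pay s t = (\<Sum>b\<in>UNIV. pmf t b * (\<Sum>a\<in>UNIV. pmf s a * M $ a $ b))"
  by (subst sum.swap) (simp add: sum_distrib_left mult_ac)

lemma pay_return: "pay s (return_pmf b) = (\<Sum>a\<in>UNIV. pmf s a * M $ a $ b)"
  by (simp add: pay_swap indicator_def if_distrib[of "\<lambda>x. x * _"] cong: if_cong)

lemma pay_bounded: "\<exists>C. \<forall>s t. \<bar>pay s t\<bar> \<le> C"
proof (intro exI allI)
  fix s t
  have "\<bar>pay s t\<bar> \<le> (\<Sum>a\<in>UNIV. \<Sum>b\<in>UNIV. \<bar>pmf s a * M $ a $ b * pmf t b\<bar>)"
    by (intro order.trans[OF sum_abs] sum_mono) auto
  also have "\<dots> \<le> (\<Sum>a\<in>UNIV. \<Sum>b\<in>UNIV. \<bar>M $ a $ b\<bar>)"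
  proof (intro sum_mono)
    fix a b
    have "pmf s a * pmf t b * \<bar>M $ a $ b\<bar> \<le> 1 * \<bar>M $ a $ b\<bar>"
      by (intro mult_right_mono mult_le_one pmf_le_1) auto
    then show "\<bar>pmf s a * M $ a $ b * pmf t b\<bar> \<le> \<bar>M $ a $ b\<bar>"
      by (simp add: abs_mult mult_ac)
  qed
  finally show "\<bar>pay s t\<bar> \<le> (\<Sum>a\<in>UNIV. \<Sum>b\<in>UNIV. \<bar>M $ a $ b\<bar>)" .
qed

text \<open>A mixed reply only averages the columns, and finitely many columns have a minimum, so
  strictness is not lost in the infimum.\<close>

lemma INF_pay_greater_iff: "(INF t. pay s t) > c \<longleftrightarrow> (\<forall>b. (\<Sum>a\<in>UNIV. pmf s a * M $ a $ b) > c)"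
proof -
  obtain C where C: "\<And>s t. \<bar>pay s t\<bar> \<le> C" using pay_bounded by blast
  have bdd: "bdd_below (range (pay s))"
    using C[of s] by (intro bdd_belowI[of _ "- C"]) (auto simp: abs_le_iff minus_le_iff)
  show ?thesis
  proof
    assume "(INF t. pay s t) > c"
    then show "\<forall>b. (\<Sum>a\<in>UNIV. pmf s a * M $ a $ b) > c"
      using cINF_lower[OF bdd, of "return_pmf _"] by (auto simp: pay_return intro: less_le_trans)
  next
    assume *: "\<forall>b. (\<Sum>a\<in>UNIV. pmf s a * M $ a $ b) > c"
    define m where "m = Min (range (\<lambda>b. \<Sum>a\<in>UNIV. pmf s a * M $ a $ b))"
    have "m > c" unfolding m_def using * by (subst Min_gr_iff) auto
    also have "m \<le> (INF t. pay s t)"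
    proof (rule cINF_greatest)
      fix t :: "'b pmf"
      have "m = (\<Sum>b\<in>UNIV. pmf t b * m)"
        by (simp flip: sum_distrib_right)
      also have "\<dots> \<le> pay s t"
        unfolding pay_swap m_def by (intro sum_mono mult_left_mono Min_le) auto
      finally show "m \<le> pay s t" .
    qed auto
    finally show "(INF t. pay s t) > c" .
  qed
qed

text \<open>A strict lower bound on a supremum has a single witness \<open>s\<close>; this allows
  all later arguments on values to avoid attainment.\<close>

lemma matrix_val_greater_iff:
  "matrix_val M > c \<longleftrightarrow> (\<exists>s. \<forall>b. (\<Sum>a\<in>UNIV. pmf s a * M $ a $ b) > c)"
proof -
  obtain C where C: "\<And>s t. \<bar>pay s t\<bar> \<le> C" using pay_bounded by blast
  have "(INF t. pay s t) \<le> C" for s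
  proof (rule cINF_lower2)
    show "bdd_below (range (pay s))"
      using C[of s] by (intro bdd_belowI[of _ "- C"]) (auto simp: abs_le_iff minus_le_iff)
    show "pay s (return_pmf undefined) \<le> C"
      using C[of s "return_pmf undefined"] by (simp only: abs_le_iff)
  qed auto
  then have "bdd_above (range (\<lambda>s. INF t. pay s t))" by (intro bdd_aboveI) auto
  then show ?thesis
    unfolding matrix_val_def by (subst less_cSUP_iff) (auto simp: INF_pay_greater_iff)
qed

text \<open>This is the homogeneous form that elimination can treat: subtracting \<open>c\<close>
  from the entries absorbs the normalisation, and positive weights are rescaled to a
  distribution.\<close>

lemma matrix_val_greater_iff_positive:
  "matrix_val M > c \<longleftrightarrow> (\<exists>x. (\<forall>a. x a > 0) \<and> (\<forall>b. (\<Sum>a\<in>UNIV. (M $ a $ b - c) * x a) > 0))"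
proof
  assume "matrix_val M > c"
  then obtain s where s: "\<And>b. (\<Sum>a\<in>UNIV. pmf s a * M $ a $ b) > c"
    by (auto simp: matrix_val_greater_iff)
  \<comment> \<open>Finitely many strict inequalities tolerate a small shift of all weights, which
    makes zero weights positive. The total changes, which homogeneity permits.\<close>
  have "\<forall>\<^sub>F e in at_right 0. \<forall>b\<in>UNIV. (\<Sum>a\<in>UNIV. (M $ a $ b - c) * (pmf s a + e)) > 0"
  proof (intro eventually_ball_finite ballI)
    fix b
    have "(\<Sum>a\<in>UNIV. (M $ a $ b - c) * (pmf s a + 0)) = (\<Sum>a\<in>UNIV. pmf s a * M $ a $ b) - c"
      by (simp add: algebra_simps sum_subtractf flip: sum_distrib_left)
    with s[of b] have pos: "(\<Sum>a\<in>UNIV. (M $ a $ b - c) * (pmf s a + 0)) > 0" by simp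
    have "((\<lambda>e. \<Sum>a\<in>UNIV. (M $ a $ b - c) * (pmf s a + e)) \<longlongrightarrow>
        (\<Sum>a\<in>UNIV. (M $ a $ b - c) * (pmf s a + 0))) (at_right 0)"
      by (intro tendsto_intros)
    then show "\<forall>\<^sub>F e in at_right 0. (\<Sum>a\<in>UNIV. (M $ a $ b - c) * (pmf s a + e)) > 0"
      by (rule order_tendstoD(1)) (rule pos)
  qed auto
  moreover have "\<forall>\<^sub>F e in at_right 0. e > (0::real)" by (rule eventually_at_right_less)
  ultimately have "\<forall>\<^sub>F e in at_right 0. e > 0 \<and>
      (\<forall>b. (\<Sum>a\<in>UNIV. (M $ a $ b - c) * (pmf s a + e)) > 0)"
    by eventually_elim simp
  then obtain e where "e > 0" "\<And>b. (\<Sum>a\<in>UNIV. (M $ a $ b - c) * (pmf s a + e)) > 0"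
    using eventually_happens'[of "at_right (0::real)"] by force
  then show "\<exists>x. (\<forall>a. x a > 0) \<and> (\<forall>b. (\<Sum>a\<in>UNIV. (M $ a $ b - c) * x a) > 0)"
    by (intro exI[of _ "\<lambda>a. pmf s a + e"]) (auto intro: add_nonneg_pos)
next
  assume "\<exists>x. (\<forall>a. x a > 0) \<and> (\<forall>b. (\<Sum>a\<in>UNIV. (M $ a $ b - c) * x a) > 0)"
  then obtain x where x: "\<And>a. x a > 0" "\<And>b. (\<Sum>a\<in>UNIV. (M $ a $ b - c) * x a) > 0" by auto
  define X where "X = (\<Sum>a\<in>UNIV. x a)"
  have X: "X > 0" unfolding X_def using x by (intro sum_pos) auto
  obtain s where s: "\<And>a. pmf s a = x a / X"
    by (rule obtain_pmf[of "\<lambda>a. x a / X"])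
      (use x X in \<open>auto simp: less_imp_le X_def simp flip: sum_divide_distrib\<close>)
  have "(\<Sum>a\<in>UNIV. pmf s a * M $ a $ b) > c" for b
  proof -
    have "X * c < (\<Sum>a\<in>UNIV. x a * M $ a $ b)"
      using x(2)[of b]
      by (simp add: algebra_simps sum_subtractf X_def sum_distrib_left)
    then show ?thesis
      using X by (simp add: s field_simps flip: sum_divide_distrib)
  qed
  then show "matrix_val M > c" by (auto simp: matrix_val_greater_iff)
qed

lemma matrix_val_ge:
  assumes "\<And>b. (\<Sum>a\<in>UNIV. pmf s a * M $ a $ b) \<ge> c"
  shows "matrix_val M \<ge> c"
proof (rule dense_le)
  fix d assume "d < c"
  then show "d \<le> matrix_val M"
    using assms less_le_trans[OF \<open>d < c\<close>]
    by (intro less_imp_le) (auto simp: matrix_val_greater_iff)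
qed

text \<open>Only weak duality is involved: an \<open>s\<close> beating \<open>c\<close> against
  every column would beat it against the mixture \<open>t\<close> too.\<close>

lemma matrix_val_le:
  assumes "\<And>a. (\<Sum>b\<in>UNIV. M $ a $ b * pmf t b) \<le> c"
  shows "matrix_val M \<le> c"
proof (rule ccontr)
  assume "\<not> matrix_val M \<le> c"
  then obtain s where s: "\<And>b. (\<Sum>a\<in>UNIV. pmf s a * M $ a $ b) > c"
    by (auto simp: matrix_val_greater_iff not_le)
  then have "(INF t. pay s t) > c" by (simp add: INF_pay_greater_iff)
  moreover obtain C where "\<And>s t. \<bar>pay s t\<bar> \<le> C" using pay_bounded by blast
  then have "bdd_below (range (pay s))"
    by (intro bdd_belowI[of _ "- C"]) (auto simp: abs_le_iff minus_le_iff)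
  then have "(INF t. pay s t) \<le> pay s t" by (rule cINF_lower) auto
  moreover have "pay s t = (\<Sum>a\<in>UNIV. pmf s a * (\<Sum>b\<in>UNIV. M $ a $ b * pmf t b))"
    by (simp add: sum_distrib_left mult_ac)
  moreover have "\<dots> \<le> (\<Sum>a\<in>UNIV. pmf s a * c)"
    by (intro sum_mono mult_left_mono assms) auto
  moreover have "\<dots> = c" by (simp flip: sum_distrib_right)
  ultimately show False by linarith
qed

end

lemma matrix_val_add_le:
  fixes A B :: "real ^ 'b::finite ^ 'a::finite"
  assumes "\<And>a b. B $ a $ b + c \<le> A $ a $ b"
  shows "matrix_val B + c \<le> matrix_val A"
proof (rule dense_le)
  fix d assume "d < matrix_val B + c"
  then have "matrix_val B > d - c" by simp
  then obtain s where s: "\<And>b. (\<Sum>a\<in>UNIV. pmf s a * B $ a $ b) > d - c"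
    by (auto simp: matrix_val_greater_iff)
  have "(\<Sum>a\<in>UNIV. pmf s a * A $ a $ b) > d" for b
  proof -
    have "(\<Sum>a\<in>UNIV. pmf s a * (B $ a $ b + c)) \<le> (\<Sum>a\<in>UNIV. pmf s a * A $ a $ b)"
      by (intro sum_mono mult_left_mono assms) auto
    then show ?thesis
      using s[of b] by (simp add: distrib_left sum.distrib flip: sum_distrib_right)
  qed
  then have "d < matrix_val A" unfolding matrix_val_greater_iff by blast
  then show "d \<le> matrix_val A" by simp
qed

lemma matrix_val_polynomial_decided_at_right:
  fixes M :: "real \<Rightarrow> real ^ 'b::finite ^ 'a::finite" and c :: "real \<Rightarrow> real"
  assumes M: "\<And>a b. real_polynomial_function (\<lambda>t. M t $ a $ b)" and c: "real_polynomial_function c"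
  shows "(\<forall>\<^sub>F t in at_right 0. matrix_val (M t) > c t) \<or>
    (\<forall>\<^sub>F t in at_right 0. \<not> matrix_val (M t) > c t)"
proof -
  define row where "row b = (\<lambda>a t. M t $ a $ b - c t)" for b
  \<comment> \<open>The row \<open>pos a\<close> is a unit vector and stands for the constraint
    \<open>x a > 0\<close>.\<close>
  define pos where "pos a = (\<lambda>a' (t::real). if a' = a then 1 else 0 :: real)" for a :: 'a
  define R where "R = range row \<union> (range pos :: ('a \<Rightarrow> real \<Rightarrow> real) set)"
  have eq: "matrix_val (M t) > c t \<longleftrightarrow> (\<exists>x. \<forall>r\<in>R. (\<Sum>a\<in>UNIV. r a t * x a) > 0)" for t
    unfolding matrix_val_greater_iff_positive R_def
    by (simp add: ball_Un row_def pos_def if_distrib[of "\<lambda>x. x * _"] conj_commute cong: if_cong)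
  have "real_polynomial_function (r v)" if "r \<in> R" for r v
    using that M c
    by (auto simp: R_def row_def pos_def intro: real_polynomial_function_diff
        real_polynomial_function.intros(2))
  moreover have "finite R" by (auto simp: R_def)
  ultimately show ?thesis
    unfolding eq by (intro fourier_motzkin_at_right) auto
qed


section \<open>Determinants of discounted transition matrices\<close>

text \<open>Row sums are only bounded by 1 because \<open>det_resolvent_ge_power\<close> sets rows
  of a transition matrix to zero.\<close>

definition substochastic :: "real ^ 'k ^ 'k \<Rightarrow> bool" where
  "substochastic Q \<longleftrightarrow> (\<forall>l l'. Q $ l $ l' \<ge> 0) \<and> (\<forall>l. (\<Sum>l'\<in>UNIV. Q $ l $ l') \<le> 1)"

lemma resolvent_nth:
  "((mat 1 - t *\<^sub>R Q) *v u) $ l = u $ l - t * (\<Sum>l'\<in>UNIV. Q $ l $ l' * u $ l')"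
  for Q :: "real ^ 'k ^ 'k" and t :: real
  unfolding matrix_vector_mult_diff_rdistrib
  by (simp add: matrix_vector_mult_def[of "t *\<^sub>R Q"] sum_distrib_left mult_ac)

text \<open>Minimum principle: at a state where \<open>u\<close> has a negative minimum
  \<open>m\<close>, the \<open>Q\<close>-average of \<open>u\<close> is at least \<open>m\<close>
  since row sums are at most 1, whence \<open>(1 - t) * m \<ge> 0\<close>, a contradiction.\<close>

lemma resolvent_nonneg:
  fixes Q :: "real ^ 'k ^ 'k" and t :: real
  assumes Q: "substochastic Q" and t: "0 \<le> t" "t < 1"
    and u: "\<And>l. ((mat 1 - t *\<^sub>R Q) *v u) $ l \<ge> 0"
  shows "u $ l \<ge> 0"
proof -
  define m where "m = Min (range (($) u))"
  have m: "m \<le> u $ l" for l unfolding m_def by (intro Min_le) auto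
  have "m \<in> range (($) u)" unfolding m_def by (rule Min_in) auto
  then obtain l0 where l0: "u $ l0 = m" by auto
  have "m \<ge> 0"
  proof (rule ccontr)
    assume "\<not> m \<ge> 0"
    have "(\<Sum>l'\<in>UNIV. Q $ l0 $ l') * m \<le> (\<Sum>l'\<in>UNIV. Q $ l0 $ l' * u $ l')"
      unfolding sum_distrib_right using Q m
      by (intro sum_mono mult_left_mono) (auto simp: substochastic_def)
    moreover have "1 * m \<le> (\<Sum>l'\<in>UNIV. Q $ l0 $ l') * m"
      using Q \<open>\<not> m \<ge> 0\<close> by (intro mult_right_mono_neg) (auto simp: substochastic_def)
    ultimately have "m \<le> (\<Sum>l'\<in>UNIV. Q $ l0 $ l' * u $ l')" by simp
    then have "t * m \<le> t * (\<Sum>l'\<in>UNIV. Q $ l0 $ l' * u $ l')"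
      using t by (intro mult_left_mono) auto
    also have "\<dots> \<le> m"
      using u[of l0] unfolding resolvent_nth l0 by simp
    finally have "0 \<le> (1 - t) * m" by (simp add: algebra_simps)
    then show False using t \<open>\<not> m \<ge> 0\<close> by (simp add: zero_le_mult_iff)
  qed
  then show ?thesis using m[of l] by simp
qed

text \<open>The minimum principle, applied to \<open>u\<close> and to \<open>- u\<close>, shows that
  the kernel is trivial.\<close>

lemma det_resolvent_nonzero:
  fixes Q :: "real ^ 'k ^ 'k" and t :: real
  assumes Q: "substochastic Q" and t: "0 \<le> t" "t < 1"
  shows "det (mat 1 - t *\<^sub>R Q) \<noteq> 0"
proof -
  have "u = 0" if "(mat 1 - t *\<^sub>R Q) *v u = 0" for u :: "real ^ 'k"
  proof -
    have "u $ l \<ge> 0" for l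
      by (rule resolvent_nonneg[OF Q t]) (simp add: that)
    moreover have "(- u) $ l \<ge> 0" for l
      by (rule resolvent_nonneg[OF Q t]) (simp add: that linear_neg[OF matrix_vector_mul_linear])
    ultimately show ?thesis by (simp add: vec_eq_iff order.antisym)
  qed
  then show ?thesis
    unfolding invertible_det_nz[symmetric] invertible_left_inverse matrix_left_invertible_ker
    by blast
qed

text \<open>The determinant is 1 at \<open>t = 0\<close> and has no zero before
  \<open>t = 1\<close>, so it stays positive there by the intermediate value theorem. The end point
  \<open>t = 1\<close>, reached by continuity, is the case that
  \<open>det_resolvent_ge_power\<close> uses.\<close>

lemma det_resolvent_nonneg:
  fixes Q :: "real ^ 'k ^ 'k" and t :: real
  assumes Q: "substochastic Q" and t: "0 \<le> t" "t \<le> 1"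
  shows "det (mat 1 - t *\<^sub>R Q) \<ge> 0"
proof -
  define d where "d t = det (mat 1 - t *\<^sub>R Q)" for t
  have cont: "continuous_on A d" for A
    unfolding d_def det_def by (intro continuous_intros)
  have d0: "d 0 = 1" by (simp add: d_def)
  have pos: "d s > 0" if s: "0 \<le> s" "s < 1" for s
  proof (rule ccontr)
    assume "\<not> d s > 0"
    then obtain r where "0 \<le> r" "r \<le> s" "d r = 0"
      using IVT2'[of d s 0 0, OF _ _ _ cont] d0 s by auto
    then show False using det_resolvent_nonzero[OF Q, of r] s by (auto simp: d_def)
  qed
  have "d t \<ge> 0"
  proof (cases "t < 1")
    case False
    with t have "t = 1" by simp
    have "isCont d 1"
      using cont[of UNIV] by (simp add: continuous_on_eq_continuous_at)
    then have "(d \<longlongrightarrow> d 1) (at_left 1)"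
      unfolding isCont_def by (rule tendsto_mono[rotated]) (simp add: at_le)
    moreover have "\<forall>\<^sub>F s in at_left 1. d s \<ge> 0"
      using eventually_at_left_real[of 0 "1::real"] by (auto elim!: eventually_mono intro: less_imp_le pos)
    ultimately show ?thesis
      unfolding \<open>t = 1\<close> by (intro tendsto_lowerbound) auto
  qed (use pos t in \<open>auto intro: less_imp_le\<close>)
  then show ?thesis by (simp add: d_def)
qed

text \<open>Each term of the Leibniz expansion takes exactly one factor from every row, and the rows
  are independent, so the mean of the product is the product of the means.\<close>

lemma expectation_det_independent_rows:
  fixes A :: "'k::finite \<Rightarrow> 'a::finite \<Rightarrow> real ^ 'k" and x :: "'k \<Rightarrow> 'a pmf"
  shows "(\<Sum>f\<in>UNIV. (\<Prod>l\<in>UNIV. pmf (x l) (f l)) * det (\<chi> l. A l (f l))) =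
    det (\<chi> l. \<Sum>a\<in>UNIV. pmf (x l) a *\<^sub>R A l a)"
proof -
  have "(\<Sum>f\<in>UNIV. (\<Prod>l\<in>UNIV. pmf (x l) (f l)) * det (\<chi> l. A l (f l))) =
      (\<Sum>f\<in>UNIV. \<Sum>p\<in>{p. p permutes UNIV}.
        of_int (sign p) * (\<Prod>l\<in>UNIV. pmf (x l) (f l) * A l (f l) $ p l))"
    by (simp add: det_def sum_distrib_left prod.distrib mult_ac)
  also have "\<dots> = (\<Sum>p\<in>{p. p permutes UNIV}.
      of_int (sign p) * (\<Sum>f\<in>UNIV. \<Prod>l\<in>UNIV. pmf (x l) (f l) * A l (f l) $ p l))"
    by (subst sum.swap) (simp add: sum_distrib_left)
  also have "\<dots> = (\<Sum>p\<in>{p. p permutes UNIV}.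
      of_int (sign p) * (\<Prod>l\<in>UNIV. \<Sum>a\<in>UNIV. pmf (x l) a * A l a $ p l))"
    by (simp add: prod_sum_PiE)
  finally show ?thesis
    by (simp add: det_def)
qed

text \<open>Row \<open>l\<close> of the matrix is the mean of the unit vector \<open>e\<^sub>l\<close>, taken with probability \<open>lam\<close>,
  and \<open>e\<^sub>l - Q\<^sub>l\<close>. All determinants with rows of these two kinds are nonnegative, and the
  identity matrix contributes the bound.\<close>
lemma det_resolvent_ge_power:
  fixes Q :: "real ^ 'k ^ 'k" and lam :: real
  assumes Q: "substochastic Q" and lam: "0 \<le> lam" "lam \<le> 1"
  shows "det (mat 1 - (1 - lam) *\<^sub>R Q) \<ge> lam ^ CARD('k)"
proof -
  define A where "A l b = (if b then axis l 1 else axis l 1 - Q $ l)" for l b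
  let ?t = "\<lambda>f. (\<Prod>l::'k\<in>UNIV. pmf (bernoulli_pmf lam) (f l)) * det (\<chi> l. A l (f l))"
  have det_nonneg: "det (\<chi> l. A l (f l)) \<ge> 0" for f
  proof -
    \<comment> \<open>Zeroing row \<open>l\<close> of \<open>Q\<close> turns row \<open>l\<close> of
      \<open>Id - Q\<close> into a unit vector, so every mixed choice of rows is again
      \<open>Id\<close> minus a substochastic matrix.\<close>
    define T where "T = (\<chi> l. if f l then 0 else Q $ l)"
    have "substochastic T"
      using Q by (auto simp: substochastic_def T_def)
    then have "det (mat 1 - 1 *\<^sub>R T) \<ge> 0" by (rule det_resolvent_nonneg) auto
    also have "mat 1 - 1 *\<^sub>R T = (\<chi> l. A l (f l))"
      by (auto simp: vec_eq_iff A_def T_def mat_def axis_def)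
    finally show ?thesis .
  qed
  have "(\<chi> l. A l True) = mat 1"
    by (auto simp: vec_eq_iff A_def mat_def axis_def)
  then have "lam ^ CARD('k) = ?t (\<lambda>_. True)"
    using lam by simp
  also have "\<dots> \<le> (\<Sum>f\<in>UNIV. ?t f)"
    by (rule member_le_sum) (auto intro!: mult_nonneg_nonneg prod_nonneg det_nonneg)
  also have "\<dots> = det (\<chi> l. \<Sum>b\<in>UNIV. pmf (bernoulli_pmf lam) b *\<^sub>R A l b)"
    by (rule expectation_det_independent_rows)
  also have "(\<chi> l. \<Sum>b\<in>UNIV. pmf (bernoulli_pmf lam) b *\<^sub>R A l b) = mat 1 - (1 - lam) *\<^sub>R Q"
    using lam by (auto simp: vec_eq_iff A_def mat_def axis_def UNIV_bool algebra_simps)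
  finally show ?thesis .
qed

text \<open>With \<open>r\<close> equal to \<open>lam\<close> times the reward vector,
  \<open>y\<close> is the discounted payoff vector of a stationary pair, and Cramer's rule gives its
  components as ratios of the two kinds of determinants.\<close>

lemma resolvent_equation:
  fixes Q :: "real ^ 'k ^ 'k" and lam :: real and r :: "real ^ 'k"
  assumes Q: "substochastic Q" and lam: "0 < lam" "lam \<le> 1"
  obtains y where "(mat 1 - (1 - lam) *\<^sub>R Q) *v y = r"
    and "\<And>k. det (replace_column k (mat 1 - (1 - lam) *\<^sub>R Q) r) =
      y $ k * det (mat 1 - (1 - lam) *\<^sub>R Q)"
    and "det (mat 1 - (1 - lam) *\<^sub>R Q) > 0"
proof -
  define P where "P = mat 1 - (1 - lam) *\<^sub>R Q"
  have "0 < lam ^ CARD('k)" using lam by simp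
  also have "\<dots> \<le> det P"
    unfolding P_def using lam by (intro det_resolvent_ge_power Q) auto
  finally have pos: "det P > 0" .
  then have "P *v (\<chi> k. det (\<chi> i j. if j = k then r $ i else P $ i $ j) / det P) = r"
    by (subst cramer) auto
  then obtain y where y: "P *v y = r" by blast
  have "det (replace_column k P r) = y $ k * det P" for k
  proof -
    have "det (replace_column k P r) = det (\<chi> i j. if j = k then (P *v y) $ i else P $ i $ j)"
      unfolding replace_column_def y by (rule refl)
    also have "\<dots> = y $ k * det P" by (rule cramer_lemma)
    finally show ?thesis .
  qed
  with y pos show ?thesis
    unfolding P_def by (intro that)
qed

text \<open>By the minimum principle a subsolution \<open>u\<close> lies below the solution
  \<open>y\<close>; multiplying by the positive determinant removes the quotient in Cramer's
  rule.\<close>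

lemma det_replace_column_resolvent_ge:
  fixes Q :: "real ^ 'k ^ 'k" and lam :: real and u r :: "real ^ 'k"
  assumes Q: "substochastic Q" and lam: "0 < lam" "lam \<le> 1"
    and u: "\<And>l. ((mat 1 - (1 - lam) *\<^sub>R Q) *v u) $ l \<le> r $ l"
  shows "u $ k * det (mat 1 - (1 - lam) *\<^sub>R Q) \<le> det (replace_column k (mat 1 - (1 - lam) *\<^sub>R Q) r)"
proof -
  obtain y where y: "(mat 1 - (1 - lam) *\<^sub>R Q) *v y = r"
    and det: "\<And>k. det (replace_column k (mat 1 - (1 - lam) *\<^sub>R Q) r) =
      y $ k * det (mat 1 - (1 - lam) *\<^sub>R Q)"
    and pos: "det (mat 1 - (1 - lam) *\<^sub>R Q) > 0"
    using resolvent_equation[OF Q lam] by blast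
  have "0 \<le> (y - u) $ k"
  proof (rule resolvent_nonneg[OF Q, of "1 - lam"])
    show "((mat 1 - (1 - lam) *\<^sub>R Q) *v (y - u)) $ l \<ge> 0" for l
      using u[of l] by (simp only: matrix_vector_mult_diff_distrib y vector_minus_component diff_ge_0_iff_ge)
  qed (use lam in auto)
  then show ?thesis unfolding det using pos by (intro mult_right_mono) auto
qed

lemma det_replace_column_resolvent_le:
  fixes Q :: "real ^ 'k ^ 'k" and lam :: real and u r :: "real ^ 'k"
  assumes Q: "substochastic Q" and lam: "0 < lam" "lam \<le> 1"
    and u: "\<And>l. ((mat 1 - (1 - lam) *\<^sub>R Q) *v u) $ l \<ge> r $ l"
  shows "u $ k * det (mat 1 - (1 - lam) *\<^sub>R Q) \<ge> det (replace_column k (mat 1 - (1 - lam) *\<^sub>R Q) r)"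
proof -
  obtain y where y: "(mat 1 - (1 - lam) *\<^sub>R Q) *v y = r"
    and det: "\<And>k. det (replace_column k (mat 1 - (1 - lam) *\<^sub>R Q) r) =
      y $ k * det (mat 1 - (1 - lam) *\<^sub>R Q)"
    and pos: "det (mat 1 - (1 - lam) *\<^sub>R Q) > 0"
    using resolvent_equation[OF Q lam] by blast
  have "0 \<le> (u - y) $ k"
  proof (rule resolvent_nonneg[OF Q, of "1 - lam"])
    show "((mat 1 - (1 - lam) *\<^sub>R Q) *v (u - y)) $ l \<ge> 0" for l
      using u[of l] by (simp only: matrix_vector_mult_diff_distrib y vector_minus_component diff_ge_0_iff_ge)
  qed (use lam in auto)
  then show ?thesis unfolding det using pos by (intro mult_right_mono) auto
qed

section \<open>Determinants averaged over one player's product mixture\<close>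

context
  fixes x :: "'k::finite \<Rightarrow> 'a::finite pmf" and h :: "'k \<Rightarrow> 'a \<Rightarrow> real" and p :: "'k \<Rightarrow> 'a \<Rightarrow> 'k pmf"
    and lam :: real and k :: 'k and u :: "'k \<Rightarrow> real"
  assumes lam: "0 < lam" "lam \<le> 1"
begin

text \<open>A pure stationary strategy of the other player is absorbed in \<open>h\<close> and
  \<open>p\<close>, so the same computation serves both players. \<open>Qx\<close> and
  \<open>rx\<close> below belong to the mixed stationary strategy \<open>x\<close>.\<close>

private definition "Q f = (\<chi> l l'. pmf (p l (f l)) l')"
private definition "D0 f = det (mat 1 - (1 - lam) *\<^sub>R Q f)"
private definition "Dk f = det (replace_column k (mat 1 - (1 - lam) *\<^sub>R Q f)
  (lam *\<^sub>R (\<chi> l. h l (f l))))"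
private definition "Qx = (\<chi> l l'. \<Sum>a\<in>UNIV. pmf (x l) a * pmf (p l a) l')"
private definition "rx = (\<chi> l. \<Sum>a\<in>UNIV. pmf (x l) a * (lam * h l a))"

private lemma pmf_prod: "pmf (Pi_pmf UNIV undefined x) f = (\<Prod>l\<in>UNIV. pmf (x l) (f l))"
  by (simp add: pmf_Pi)

private lemma expectation_D0:
  "(\<Sum>f\<in>UNIV. pmf (Pi_pmf UNIV undefined x) f * D0 f) = det (mat 1 - (1 - lam) *\<^sub>R Qx)"
proof -
  define A where "A l a = (\<chi> l'. mat 1 $ l $ l' - (1 - lam) * pmf (p l a) l')" for l a
  have "mat 1 - (1 - lam) *\<^sub>R Q f = (\<chi> l. A l (f l))" for f
    by (simp add: vec_eq_iff A_def Q_def)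
  moreover have "mat 1 - (1 - lam) *\<^sub>R Qx = (\<chi> l. \<Sum>a\<in>UNIV. pmf (x l) a *\<^sub>R A l a)"
    by (simp add: vec_eq_iff A_def Qx_def right_diff_distrib sum_subtractf sum_distrib_left mult_ac
        flip: sum_distrib_right)
  ultimately show ?thesis
    by (simp add: D0_def pmf_prod expectation_det_independent_rows)
qed

text \<open>The new entry in column \<open>k\<close> of row \<open>l\<close> depends on
  \<open>f\<close> only through \<open>f l\<close>, so the rows are still independent.\<close>

private lemma expectation_Dk:
  "(\<Sum>f\<in>UNIV. pmf (Pi_pmf UNIV undefined x) f * Dk f) =
    det (replace_column k (mat 1 - (1 - lam) *\<^sub>R Qx) rx)"
proof -
  define A where "A l a = (\<chi> l'. if l' = k then lam * h l a
    else mat 1 $ l $ l' - (1 - lam) * pmf (p l a) l')" for l a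
  have "replace_column k (mat 1 - (1 - lam) *\<^sub>R Q f) (lam *\<^sub>R (\<chi> l. h l (f l))) =
      (\<chi> l. A l (f l))" for f
    by (simp add: vec_eq_iff A_def Q_def replace_column_def)
  moreover have "replace_column k (mat 1 - (1 - lam) *\<^sub>R Qx) rx =
      (\<chi> l. \<Sum>a\<in>UNIV. pmf (x l) a *\<^sub>R A l a)"
    by (simp add: vec_eq_iff A_def Qx_def rx_def replace_column_def right_diff_distrib
        sum_subtractf sum_distrib_left mult_ac flip: sum_distrib_right)
  ultimately show ?thesis
    by (simp add: Dk_def pmf_prod expectation_det_independent_rows)
qed

private lemma substochastic_Qx: "substochastic Qx"
  unfolding substochastic_def
proof (intro conjI allI)
  show "Qx $ l $ l' \<ge> 0" for l l'
    by (auto simp: Qx_def intro!: sum_nonneg)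
  show "(\<Sum>l'\<in>UNIV. Qx $ l $ l') \<le> 1" for l
    by (simp add: Qx_def) (subst sum.swap, simp flip: sum_distrib_left)
qed

private lemma resolvent_Qx_nth:
  "((mat 1 - (1 - lam) *\<^sub>R Qx) *v (\<chi> l. u l)) $ l =
    u l - (\<Sum>a\<in>UNIV. pmf (x l) a * ((1 - lam) * (\<Sum>l'\<in>UNIV. pmf (p l a) l' * u l')))"
proof -
  have "(\<Sum>l'\<in>UNIV. Qx $ l $ l' * u l') =
      (\<Sum>a\<in>UNIV. pmf (x l) a * (\<Sum>l'\<in>UNIV. pmf (p l a) l' * u l'))"
  proof -
    have "(\<Sum>l'\<in>UNIV. Qx $ l $ l' * u l') =
        (\<Sum>l'\<in>UNIV. \<Sum>a\<in>UNIV. pmf (x l) a * (pmf (p l a) l' * u l'))"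
      by (simp add: Qx_def sum_distrib_left sum_distrib_right mult_ac)
    also have "\<dots> = (\<Sum>a\<in>UNIV. \<Sum>l'\<in>UNIV. pmf (x l) a * (pmf (p l a) l' * u l'))"
      by (rule sum.swap)
    finally show ?thesis by (simp add: sum_distrib_left)
  qed
  then show ?thesis
    by (simp add: resolvent_nth sum_distrib_left mult_ac)
qed

private lemma expectation_diff:
  "(\<Sum>f\<in>UNIV. pmf (Pi_pmf UNIV undefined x) f * (Dk f - u k * D0 f)) =
    det (replace_column k (mat 1 - (1 - lam) *\<^sub>R Qx) rx) - u k * det (mat 1 - (1 - lam) *\<^sub>R Qx)"
  by (simp add: right_diff_distrib sum_subtractf mult.left_commute expectation_Dk
      flip: expectation_D0 sum_distrib_left)

text \<open>The hypothesis says that \<open>u\<close> is a subsolution of the averaged resolvent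
  equation given by \<open>Qx\<close> and \<open>rx\<close>.\<close>

lemma expectation_cramer_nonneg:
  assumes "\<And>l. u l \<le> (\<Sum>a\<in>UNIV. pmf (x l) a *
    (lam * h l a + (1 - lam) * (\<Sum>l'\<in>UNIV. pmf (p l a) l' * u l')))"
  shows "(\<Sum>f\<in>UNIV. pmf (Pi_pmf UNIV undefined x) f *
    (det (replace_column k (mat 1 - (1 - lam) *\<^sub>R (\<chi> l l'. pmf (p l (f l)) l'))
      (lam *\<^sub>R (\<chi> l. h l (f l)))) -
     u k * det (mat 1 - (1 - lam) *\<^sub>R (\<chi> l l'. pmf (p l (f l)) l')))) \<ge> 0"
  using det_replace_column_resolvent_ge[OF substochastic_Qx lam, of "\<chi> l. u l" rx k] assms
  unfolding expectation_diff[unfolded Dk_def D0_def Q_def] resolvent_Qx_nth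
  by (simp add: rx_def sum.distrib sum_subtractf algebra_simps)

lemma expectation_cramer_nonpos:
  assumes "\<And>l. u l \<ge> (\<Sum>a\<in>UNIV. pmf (x l) a *
    (lam * h l a + (1 - lam) * (\<Sum>l'\<in>UNIV. pmf (p l a) l' * u l')))"
  shows "(\<Sum>f\<in>UNIV. pmf (Pi_pmf UNIV undefined x) f *
    (det (replace_column k (mat 1 - (1 - lam) *\<^sub>R (\<chi> l l'. pmf (p l (f l)) l'))
      (lam *\<^sub>R (\<chi> l. h l (f l)))) -
     u k * det (mat 1 - (1 - lam) *\<^sub>R (\<chi> l l'. pmf (p l (f l)) l')))) \<le> 0"
  using det_replace_column_resolvent_le[OF substochastic_Qx lam, of rx "\<chi> l. u l" k] assms
  unfolding expectation_diff[unfolded Dk_def D0_def Q_def] resolvent_Qx_nth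
  by (simp add: rx_def sum.distrib sum_subtractf algebra_simps)

end

lemma substochastic_trans_mat: "substochastic (trans_mat q i j)"
  by (simp add: substochastic_def trans_mat_def)

lemma det0_ge_power:
  fixes q :: "('k::finite, 'i, 'j) transition"
  assumes "0 \<le> lam" "lam \<le> 1"
  shows "det0 q lam i j \<ge> lam ^ CARD('k)"
  unfolding det0_def disc_mat_def using assms by (intro det_resolvent_ge_power substochastic_trans_mat)

text \<open>The inequalities on \<open>u\<close> say that in the one-shot game with continuation payoff \<open>u\<close>
  the mixed action \<open>x l\<close> (respectively \<open>y l\<close>) guarantees \<open>u l\<close>; the product mixture of these
  actions then guarantees \<open>0\<close> in the auxiliary matrix game.\<close>
lemma matrix_val_W_nonneg:
  fixes g :: "('k::finite, 'i::finite, 'j::finite) reward" and q :: "('k, 'i, 'j) transition"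
  assumes lam: "0 < lam" "lam \<le> 1"
    and x: "\<And>l j. u l \<le> (\<Sum>i\<in>UNIV. pmf (x l) i *
      (lam * g l i j + (1 - lam) * (\<Sum>l'\<in>UNIV. pmf (q l i j) l' * u l')))"
  shows "matrix_val (W g q k lam (u k)) \<ge> 0"
proof (rule matrix_val_ge)
  show "(\<Sum>i\<in>UNIV. pmf (Pi_pmf UNIV undefined x) i * W g q k lam (u k) $ i $ j) \<ge> 0" for j
    using expectation_cramer_nonneg[OF lam, of u x "\<lambda>l i. g l i (j l)" "\<lambda>l i. q l i (j l)" k, OF x]
    by (simp add: W_def detk_def det0_def disc_mat_def trans_mat_def reward_vec_def)
qed

lemma matrix_val_W_nonpos:
  fixes g :: "('k::finite, 'i::finite, 'j::finite) reward" and q :: "('k, 'i, 'j) transition"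
  assumes lam: "0 < lam" "lam \<le> 1"
    and y: "\<And>l i. u l \<ge> (\<Sum>j\<in>UNIV. pmf (y l) j *
      (lam * g l i j + (1 - lam) * (\<Sum>l'\<in>UNIV. pmf (q l i j) l' * u l')))"
  shows "matrix_val (W g q k lam (u k)) \<le> 0"
proof (rule matrix_val_le)
  show "(\<Sum>j\<in>UNIV. W g q k lam (u k) $ i $ j * pmf (Pi_pmf UNIV undefined y) j) \<le> 0" for i
    using expectation_cramer_nonpos[OF lam, of y "\<lambda>l j. g l (i l) j" "\<lambda>l j. q l (i l) j" u k, OF y]
    by (simp add: W_def detk_def det0_def disc_mat_def trans_mat_def reward_vec_def mult.commute)
qed

section \<open>Polynomial dependence on \<open>lam\<close> and existence of the limit\<close>

lemma real_polynomial_function_det: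
  fixes A :: "real \<Rightarrow> real ^ 'k ^ 'k"
  assumes "\<And>l l'. real_polynomial_function (\<lambda>t. A t $ l $ l')"
  shows "real_polynomial_function (\<lambda>t. det (A t))"
  unfolding det_def using assms
  by (intro real_polynomial_function_sum real_polynomial_function_prod
      real_polynomial_function.intros(2,4)) auto

lemma real_polynomial_function_ident [simp]: "real_polynomial_function (\<lambda>t. t)"
  by (intro real_polynomial_function.intros(1) bounded_linear_ident)

lemma real_polynomial_function_W:
  "real_polynomial_function (\<lambda>lam. W g q k lam z $ i $ j)"
  unfolding W_def detk_def det0_def disc_mat_def replace_column_def
proof (simp, intro real_polynomial_function_diff real_polynomial_function.intros(2,4)
    real_polynomial_function_det)
  have entry: "real_polynomial_function (\<lambda>lam. mat 1 $ l $ l' - (1 - lam) * trans_mat q i j $ l $ l')"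
    for l l'
    by (intro real_polynomial_function_diff real_polynomial_function.intros(2,4)
        real_polynomial_function_ident)
  then show "real_polynomial_function (\<lambda>lam. (mat 1 - (1 - lam) *\<^sub>R trans_mat q i j) $ l $ l')"
    for l l'
    by simp
  show "real_polynomial_function (\<lambda>lam. (\<chi> l l'. if l' = k then (lam *\<^sub>R reward_vec g i j) $ l
      else (mat 1 - (1 - lam) *\<^sub>R trans_mat q i j) $ l $ l') $ l $ l')" for l l'
    using entry[of l l']
    by (cases "l' = k") (auto intro: real_polynomial_function.intros(2,4))
qed

text \<open>Clearing the positive denominator turns a constant threshold \<open>c\<close> for the
  quotient into the threshold \<open>c * lam ^ n\<close> for the value; this is why values are
  compared with polynomials.\<close>

lemma W_quot_converges: "\<exists>L. (W_quot g q k z \<longlongrightarrow> L) (at_right 0)"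
  unfolding W_quot_def
proof (rule tendsto_ereal_if_eventually_decided)
  fix c :: real
  let ?n = "CARD('a)"
  have pos: "\<forall>\<^sub>F lam in at_right 0. lam > (0::real)" by (rule eventually_at_right_less)
  have iff: "matrix_val (W g q k lam z) / lam ^ ?n > c \<longleftrightarrow> matrix_val (W g q k lam z) > c * lam ^ ?n"
    if "lam > 0" for lam :: real
    using that by (simp add: field_simps)
  have "real_polynomial_function (\<lambda>lam. c * lam ^ ?n)"
    by (intro real_polynomial_function.intros(2,4) real_polynomial_function_power) simp
  from matrix_val_polynomial_decided_at_right[OF real_polynomial_function_W this]
  show "(\<forall>\<^sub>F lam in at_right 0. matrix_val (W g q k lam z) / lam ^ ?n > c) \<or>
      (\<forall>\<^sub>F lam in at_right 0. \<not> matrix_val (W g q k lam z) / lam ^ ?n > c)"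
  proof
    assume "\<forall>\<^sub>F lam in at_right 0. matrix_val (W g q k lam z) > c * lam ^ ?n"
    with pos have "\<forall>\<^sub>F lam in at_right 0. matrix_val (W g q k lam z) / lam ^ ?n > c"
      by eventually_elim (simp add: iff)
    then show ?thesis ..
  next
    assume "\<forall>\<^sub>F lam in at_right 0. \<not> matrix_val (W g q k lam z) > c * lam ^ ?n"
    with pos have "\<forall>\<^sub>F lam in at_right 0. \<not> matrix_val (W g q k lam z) / lam ^ ?n > c"
      by eventually_elim (simp add: iff)
    then show ?thesis ..
  qed
qed


section \<open>Stationary equilibria of discounted games\<close>

text \<open>Profiles are vectors indexed by state-action pairs, so that they form a compact convex
  subset of a Euclidean space, as Brouwer's theorem requires.\<close>

definition mixed_profiles :: "(real ^ ('k::finite \<times> 'a::finite)) set" where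
  "mixed_profiles = {x. (\<forall>l a. 0 \<le> x $ (l, a)) \<and> (\<forall>l. (\<Sum>a\<in>UNIV. x $ (l, a)) = 1)}"

lemma mixed_profiles_compact: "compact (mixed_profiles :: (real ^ ('k::finite \<times> 'a::finite)) set)"
proof -
  have "x $ (l, a) \<le> 1" if "x \<in> mixed_profiles" for x :: "real ^ ('k \<times> 'a)" and l a
    using that member_le_sum[of a UNIV "\<lambda>a. x $ (l, a)"] by (auto simp: mixed_profiles_def)
  then have eq: "(mixed_profiles :: (real ^ ('k \<times> 'a)) set) =
      cbox 0 1 \<inter> {x. \<forall>l. (\<Sum>a\<in>UNIV. x $ (l, a)) = 1}"
    by (auto simp: mixed_profiles_def mem_box_cart)
  have "closed {x :: real ^ ('k \<times> 'a). \<forall>l. (\<Sum>a\<in>UNIV. x $ (l, a)) = 1}"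
    by (intro closed_Collect_all closed_Collect_eq continuous_intros)
  then show ?thesis unfolding eq by (intro compact_Int_closed compact_cbox)
qed

lemma mixed_profiles_convex: "convex (mixed_profiles :: (real ^ ('k::finite \<times> 'a::finite)) set)"
proof (rule convexI)
  fix x y :: "real ^ ('k \<times> 'a)" and s t :: real
  assume "x \<in> mixed_profiles" "y \<in> mixed_profiles" "0 \<le> s" "0 \<le> t" "s + t = 1"
  then show "s *\<^sub>R x + t *\<^sub>R y \<in> mixed_profiles"
    by (auto simp: mixed_profiles_def sum.distrib simp flip: sum_distrib_left)
qed

lemma mixed_profiles_nonempty: "(mixed_profiles :: (real ^ ('k::finite \<times> 'a::finite)) set) \<noteq> {}"
proof -
  have "(\<chi> la. if snd la = undefined then 1 else 0) \<in> (mixed_profiles :: (real ^ ('k \<times> 'a)) set)"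
    by (auto simp: mixed_profiles_def)
  then show ?thesis by blast
qed

lemma mixed_profile_pmf:
  assumes "x \<in> mixed_profiles"
  shows "\<exists>\<xi> :: 'k::finite \<Rightarrow> 'a::finite pmf. \<forall>l a. pmf (\<xi> l) a = x $ (l, a)"
proof -
  have "\<exists>s. \<forall>a. pmf s a = x $ (l, a)" for l
  proof -
    obtain s where "\<And>a. pmf s a = x $ (l, a)"
      by (rule obtain_pmf[of "\<lambda>a. x $ (l, a)"])
        (use assms in \<open>auto simp: mixed_profiles_def\<close>)
    then show ?thesis by blast
  qed
  then show ?thesis by metis
qed

text \<open>At a fixed point the gain of each action is its weight times the total gain
  \<open>E\<close>. The mean \<open>v\<close> cannot be exceeded by all actions in use, so some
  action of positive weight has gain 0; hence \<open>E = 0\<close> and no action gains.\<close>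

lemma nash_map_fixed_point:
  fixes w c :: "'a::finite \<Rightarrow> real"
  assumes w: "\<And>a. w a \<ge> 0" "(\<Sum>a\<in>UNIV. w a) = 1" and v: "v = (\<Sum>a\<in>UNIV. w a * c a)"
    and fixed: "\<And>a. (w a + max 0 (c a - v)) / (1 + (\<Sum>a\<in>UNIV. max 0 (c a - v))) = w a"
  shows "c a \<le> v"
proof -
  define E where "E = (\<Sum>a\<in>UNIV. max 0 (c a - v))"
  have E: "E \<ge> 0" unfolding E_def by (intro sum_nonneg) auto
  have gain: "max 0 (c a - v) = w a * E" for a
    using fixed[of a] E unfolding E_def[symmetric] by (simp add: field_simps)
  have "\<exists>b. w b > 0 \<and> c b \<le> v"
  proof (rule ccontr)
    assume contr: "\<not> ?thesis"
    have pos: "c b > v" if "w b > 0" for b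
      using contr that not_le by blast
    have sum0: "(\<Sum>a\<in>UNIV. w a * (c a - v)) = 0"
      by (simp add: right_diff_distrib sum_subtractf v w(2) flip: sum_distrib_right)
    have nonneg: "w a * (c a - v) \<ge> 0" for a
      using pos[of a] w(1)[of a] by (cases "w a > 0") auto
    have prod0: "w a * (c a - v) = 0" for a
      using sum_nonneg_eq_0_iff[of UNIV "\<lambda>a. w a * (c a - v)"] sum0 nonneg by simp
    have "w a = 0" for a
      using prod0[of a] pos[of a] w(1)[of a] by (cases "w a > 0") auto
    with w(2) show False by simp
  qed
  then obtain b where "w b > 0" "c b \<le> v" by blast
  with gain[of b] have "E = 0" by simp
  with gain[of a] show ?thesis by simp
qed

lemma one_plus_sum_pos_part: "1 + (\<Sum>i\<in>A. max 0 (h i)) > (0::real)"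
  by (intro add_pos_nonneg sum_nonneg) auto

lemma abs_average_le:
  fixes w h :: "'x::finite \<Rightarrow> real"
  assumes "\<And>x. w x \<ge> 0" "(\<Sum>x\<in>UNIV. w x) = 1" "\<And>x. \<bar>h x\<bar> \<le> G"
  shows "\<bar>\<Sum>x\<in>UNIV. w x * h x\<bar> \<le> G"
proof -
  have "\<bar>\<Sum>x\<in>UNIV. w x * h x\<bar> \<le> (\<Sum>x\<in>UNIV. w x * G)"
    using assms by (intro order.trans[OF sum_abs] sum_mono) (auto simp: abs_mult intro!: mult_left_mono)
  then show ?thesis using assms by (simp flip: sum_distrib_right)
qed

text \<open>The stationary strategies \<open>x\<close>, \<open>y\<close> and the values \<open>u\<close> of the discounted game are found
  simultaneously, as a fixed point of the map that applies Nash's improvement step to each local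
  one-shot game and replaces \<open>u\<close> by the local payoffs. This needs no minimax theorem.\<close>
lemma discounted_equilibrium:
  fixes g :: "('k::finite, 'i::finite, 'j::finite) reward" and q :: "('k, 'i, 'j) transition"
  assumes lam: "0 \<le> lam" "lam \<le> 1" and g: "\<And>l i j. \<bar>g l i j\<bar> \<le> G"
  obtains x :: "'k \<Rightarrow> 'i pmf" and y :: "'k \<Rightarrow> 'j pmf" and u :: "'k \<Rightarrow> real"
  where "\<And>l j. u l \<le> (\<Sum>i\<in>UNIV. pmf (x l) i *
      (lam * g l i j + (1 - lam) * (\<Sum>l'\<in>UNIV. pmf (q l i j) l' * u l')))"
    and "\<And>l i. u l \<ge> (\<Sum>j\<in>UNIV. pmf (y l) j *
      (lam * g l i j + (1 - lam) * (\<Sum>l'\<in>UNIV. pmf (q l i j) l' * u l')))"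
    and "\<And>l. \<bar>u l\<bar> \<le> G"
proof -
  \<comment> \<open>\<open>m\<close> is the payoff of the one-shot game in state \<open>l\<close>
    with continuation \<open>u\<close>; \<open>p1\<close> and \<open>p2\<close> are its values for a
    pure action against the other player's mixture, and \<open>v\<close> is its value for the two
    mixtures.\<close>
  define m where "m l i j u = lam * g l i j + (1 - lam) * (\<Sum>l'\<in>UNIV. pmf (q l i j) l' * u $ l')"
    for l i j and u :: "real ^ 'k"
  define p1 where "p1 l i b u = (\<Sum>j\<in>UNIV. b $ (l, j) * m l i j u)" for l i and b :: "real ^ ('k \<times> 'j)" and u
  define p2 where "p2 l j a u = (\<Sum>i\<in>UNIV. a $ (l, i) * m l i j u)" for l j and a :: "real ^ ('k \<times> 'i)" and u
  define v where "v l a b u = (\<Sum>i\<in>UNIV. a $ (l, i) * p1 l i b u)"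
    for l and a :: "real ^ ('k \<times> 'i)" and b :: "real ^ ('k \<times> 'j)" and u
  have v_alt: "v l a b u = (\<Sum>j\<in>UNIV. b $ (l, j) * p2 l j a u)" for l a b u
    unfolding v_def p1_def p2_def sum_distrib_left
    by (subst sum.swap) (simp add: mult_ac)
  define f1 where "f1 a b u = (\<chi> la. case la of (l, i) \<Rightarrow> (a $ (l, i) + max 0 (p1 l i b u - v l a b u)) /
    (1 + (\<Sum>i\<in>UNIV. max 0 (p1 l i b u - v l a b u))))" for a b u
  define f2 where "f2 a b u = (\<chi> la. case la of (l, j) \<Rightarrow> (b $ (l, j) + max 0 (v l a b u - p2 l j a u)) /
    (1 + (\<Sum>j\<in>UNIV. max 0 (v l a b u - p2 l j a u))))" for a b u
  define f where "f = (\<lambda>(a, b, u). (f1 a b u, f2 a b u, \<chi> l. v l a b u))"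
  \<comment> \<open>The box for \<open>u\<close> is invariant because local payoffs are convex
    combinations of rewards and continuation values, all bounded by \<open>G\<close>.\<close>
  define S where "S = (mixed_profiles :: (real ^ ('k \<times> 'i)) set) \<times>
    (mixed_profiles :: (real ^ ('k \<times> 'j)) set) \<times> cbox (\<chi> l. - G) (\<chi> l. G :: real ^ 'k)"
  have G: "0 \<le> G" using g[of undefined undefined undefined] by linarith
  note pos = one_plus_sum_pos_part and nz = one_plus_sum_pos_part[THEN less_imp_neq, symmetric]
  obtain z where z: "z \<in> S" "f z = z"
  proof (rule brouwer)
    show "compact S"
      unfolding S_def by (intro compact_Times mixed_profiles_compact compact_cbox)
    show "convex S"
      unfolding S_def by (intro convex_Times mixed_profiles_convex convex_box)
    have "(0 :: real ^ 'k) \<in> cbox (\<chi> l. - G) (\<chi> l. G)"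
      using G by (simp add: mem_box_cart)
    then have "cbox (\<chi> l. - G) (\<chi> l. G) \<noteq> ({} :: (real ^ 'k) set)" by blast
    then show "S \<noteq> {}"
      unfolding S_def by (simp only: Times_empty mixed_profiles_nonempty simp_thms)
    have c1: "continuous_on S (\<lambda>z. p1 l i (fst (snd z)) (snd (snd z)))" for l i
      unfolding p1_def m_def by (intro continuous_intros)
    have c2: "continuous_on S (\<lambda>z. p2 l j (fst z) (snd (snd z)))" for l j
      unfolding p2_def m_def by (intro continuous_intros)
    have cv: "continuous_on S (\<lambda>z. v l (fst z) (fst (snd z)) (snd (snd z)))" for l
      unfolding v_def by (intro continuous_intros c1)
    have cf1: "continuous_on S (\<lambda>z. f1 (fst z) (fst (snd z)) (snd (snd z)))"
      unfolding f1_def case_prod_beta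
      by (intro continuous_on_vec_lambda continuous_on_divide continuous_on_add continuous_on_sum
          continuous_on_max continuous_on_diff c1 cv continuous_on_const continuous_on_component
          continuous_on_fst continuous_on_id ballI nz)
    have cf2: "continuous_on S (\<lambda>z. f2 (fst z) (fst (snd z)) (snd (snd z)))"
      unfolding f2_def case_prod_beta
      by (intro continuous_on_vec_lambda continuous_on_divide continuous_on_add continuous_on_sum
          continuous_on_max continuous_on_diff c2 cv continuous_on_const continuous_on_component
          continuous_on_fst continuous_on_snd continuous_on_id ballI nz)
    show "continuous_on S f"
      unfolding f_def case_prod_beta
      by (intro continuous_on_Pair continuous_on_vec_lambda cf1 cf2 cv)
    show "f \<in> S \<rightarrow> S"
    proof
      fix z assume "z \<in> S"
      then obtain a b u where zeq: "z = (a, b, u)" and a: "a \<in> mixed_profiles"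
        and b: "b \<in> mixed_profiles" and u: "\<And>l. \<bar>u $ l\<bar> \<le> G"
        by (cases z) (auto simp: S_def mem_box_cart abs_le_iff minus_le_iff)
      have "f1 a b u \<in> mixed_profiles"
        using a by (auto simp: f1_def mixed_profiles_def sum.distrib nz intro!: divide_nonneg_pos pos
            simp flip: sum_divide_distrib)
      moreover have "f2 a b u \<in> mixed_profiles"
        using b by (auto simp: f2_def mixed_profiles_def sum.distrib nz intro!: divide_nonneg_pos pos
            simp flip: sum_divide_distrib)
      moreover have "\<bar>v l a b u\<bar> \<le> G" for l
      proof -
        have "\<bar>m l i j u\<bar> \<le> G" for i j
        proof -
          have "\<bar>m l i j u\<bar> \<le> lam * \<bar>g l i j\<bar> + (1 - lam) * \<bar>\<Sum>l'\<in>UNIV. pmf (q l i j) l' * u $ l'\<bar>"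
            unfolding m_def using lam by (intro order.trans[OF abs_triangle_ineq]) (simp add: abs_mult)
          also have "\<dots> \<le> lam * G + (1 - lam) * G"
            using lam g u abs_average_le[of "pmf (q l i j)" "($) u"] by (intro add_mono mult_left_mono) auto
          finally show ?thesis by (simp add: algebra_simps)
        qed
        then have "\<bar>p1 l i b u\<bar> \<le> G" for i
          unfolding p1_def using b by (intro abs_average_le) (auto simp: mixed_profiles_def)
        then show ?thesis
          unfolding v_def using a by (intro abs_average_le) (auto simp: mixed_profiles_def)
      qed
      ultimately show "f z \<in> S"
        by (auto simp: zeq f_def S_def mem_box_cart abs_le_iff minus_le_iff)
    qed
  qed
  obtain a b u where zeq: "z = (a, b, u)" by (cases z) auto
  have ab: "a \<in> mixed_profiles" "b \<in> mixed_profiles" and uG: "\<And>l. \<bar>u $ l\<bar> \<le> G"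
    using z(1) by (auto simp: zeq S_def mem_box_cart abs_le_iff minus_le_iff)
  have fixed: "f1 a b u = a" "f2 a b u = b" and "(\<chi> l. v l a b u) = u"
    using z(2) by (auto simp: zeq f_def)
  then have u: "v l a b u = u $ l" for l
    by (metis vec_lambda_beta)
  obtain x :: "'k \<Rightarrow> 'i pmf" where x: "\<And>l i. pmf (x l) i = a $ (l, i)"
    using mixed_profile_pmf[OF ab(1)] by blast
  obtain y :: "'k \<Rightarrow> 'j pmf" where y: "\<And>l j. pmf (y l) j = b $ (l, j)"
    using mixed_profile_pmf[OF ab(2)] by blast
  have le: "p1 l i b u \<le> v l a b u" for l i
  proof (rule nash_map_fixed_point[where w = "\<lambda>i. a $ (l, i)"])
    show "(a $ (l, i) + max 0 (p1 l i b u - v l a b u)) /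
        (1 + (\<Sum>i\<in>UNIV. max 0 (p1 l i b u - v l a b u))) = a $ (l, i)" for i
      using arg_cong[OF fixed(1), of "\<lambda>a. a $ (l, i)"] by (simp add: f1_def)
  qed (use ab(1) in \<open>auto simp: mixed_profiles_def v_def\<close>)
  \<comment> \<open>Player 2 minimises, so the fixed point lemma is applied to the negated
    payoffs.\<close>
  have ge: "- p2 l j a u \<le> - v l a b u" for l j
  proof (rule nash_map_fixed_point[where w = "\<lambda>j. b $ (l, j)" and c = "\<lambda>j. - p2 l j a u"])
    show "(b $ (l, j) + max 0 (- p2 l j a u - - v l a b u)) /
        (1 + (\<Sum>j\<in>UNIV. max 0 (- p2 l j a u - - v l a b u))) = b $ (l, j)" for j
      using arg_cong[OF fixed(2), of "\<lambda>b. b $ (l, j)"] by (simp add: f2_def)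
  qed (use ab(2) in \<open>auto simp: mixed_profiles_def v_alt sum_negf\<close>)
  show ?thesis
  proof (rule that[of "\<lambda>l. u $ l" x y])
    show "u $ l \<le> (\<Sum>i\<in>UNIV. pmf (x l) i *
        (lam * g l i j + (1 - lam) * (\<Sum>l'\<in>UNIV. pmf (q l i j) l' * u $ l')))" for l j
      using ge[of l j] by (simp add: u x p2_def m_def)
    show "u $ l \<ge> (\<Sum>j\<in>UNIV. pmf (y l) j *
        (lam * g l i j + (1 - lam) * (\<Sum>l'\<in>UNIV. pmf (q l i j) l' * u $ l')))" for l i
      using le[of l i] by (simp add: u y p1_def m_def)
  qed (rule uG)
qed


section \<open>The law of the play\<close>

context
  fixes q :: "('k::finite, 'i::finite, 'j::finite) transition" and k :: 'k
    and \<sigma> :: "('k, 'i, 'j) strategy1" and \<tau> :: "('k, 'i, 'j) strategy2"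
begin

private abbreviation "P \<equiv> play_measure q k \<sigma> \<tau>"
private abbreviation "N \<equiv> (\<lambda>_::nat. count_space (UNIV :: ('k \<times> 'i \<times> 'j) set))"

interpretation IT: Ionescu_Tulcea "\<lambda>m \<omega>. measure_pmf (stage_pmf q k \<sigma> \<tau> m \<omega>)" N
  by (rule Ionescu_Tulcea_stage)

interpretation play: prob_space P
  by (rule prob_space_play_measure)

lemma sets_play_measure [measurable_cong]: "sets P = sets (PiM UNIV N)"
  by (simp add: play_measure_def)

lemma space_play_measure: "space P = UNIV"
  by (simp add: play_measure_def space_PiM)

text \<open>Histories of fixed length form a finite set with the discrete sigma-algebra.\<close>

lemma borel_measurable_history:
  "f \<in> borel_measurable (PiM {0..<m} N)" for f :: "(nat \<Rightarrow> 'k \<times> 'i \<times> 'j) \<Rightarrow> 'c::topological_space"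
proof -
  have "PiM {0..<m} N = count_space ({0..<m} \<rightarrow>\<^sub>E UNIV)"
    by (rule count_space_PiM_finite) auto
  then show ?thesis by simp
qed

lemma measurable_restrict_play: "(\<lambda>\<omega>. restrict \<omega> {0..<m}) \<in> P \<rightarrow>\<^sub>M PiM {0..<m} N"
  unfolding measurable_cong_sets[OF sets_play_measure refl] by (rule measurable_restrict_subset) simp

text \<open>This reduces the projective limit to finitely many kernel steps: the two measures agree
  because the limit is prescribed on cylinder sets.\<close>

lemma distr_play_measure:
  "distr P (PiM {0..<m} N) (\<lambda>\<omega>. restrict \<omega> {0..<m}) = IT.C 0 m (\<lambda>_. undefined)"
proof (rule measure_eqI)
  have [simp]: "(\<lambda>_. undefined) \<in> space (PiM {} N)"
    by (simp add: space_PiM)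
  have sets_C: "sets (IT.C 0 m (\<lambda>_. undefined)) = sets (PiM {0..<m} N)"
    using IT.sets_C[of "\<lambda>_. undefined" 0 m] by simp
  then show "sets (distr P (PiM {0..<m} N) (\<lambda>\<omega>. restrict \<omega> {0..<m})) = sets (IT.C 0 m (\<lambda>_. undefined))"
    by simp
  fix X assume "X \<in> sets (distr P (PiM {0..<m} N) (\<lambda>\<omega>. restrict \<omega> {0..<m}))"
  then have X: "X \<in> sets (PiM {0..<m} N)" by simp
  have "emeasure (distr P (PiM {0..<m} N) (\<lambda>\<omega>. restrict \<omega> {0..<m})) X =
      emeasure P ((\<lambda>\<omega>. restrict \<omega> {0..<m}) -` X \<inter> space P)"
    using X by (intro emeasure_distr measurable_restrict_play)
  also have "(\<lambda>\<omega>. restrict \<omega> {0..<m}) -` X \<inter> space P = IT.PF.emb UNIV {0..<m} X"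
    by (auto simp: space_play_measure prod_emb_def)
  also have "emeasure P \<dots> = emeasure (IT.CI {0..<m}) X"
    unfolding play_measure_def using X by (intro IT.lim) auto
  also have "\<dots> = emeasure (IT.C 0 m (\<lambda>_. undefined)) (IT.PF.emb {0..<m} {0..<m} X)"
    using X by (intro IT.emeasure_CI) auto
  also have "IT.PF.emb {0..<m} {0..<m} X = X"
    using sets.sets_into_space[OF X] by (intro prod_emb_id) (simp add: space_PiM)
  finally show "emeasure (distr P (PiM {0..<m} N) (\<lambda>\<omega>. restrict \<omega> {0..<m})) X =
      emeasure (IT.C 0 m (\<lambda>_. undefined)) X" .
qed

lemma nn_integral_play_history:
  fixes f :: "(nat \<Rightarrow> 'k \<times> 'i \<times> 'j) \<Rightarrow> ennreal"
  shows "(\<integral>\<^sup>+\<omega>. f (restrict \<omega> {0..<m}) \<partial>P) = (\<integral>\<^sup>+\<omega>. f \<omega> \<partial>IT.C 0 m (\<lambda>_. undefined))"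
  unfolding distr_play_measure[symmetric]
  by (rule nn_integral_distr[OF measurable_restrict_play, symmetric])
    (simp add: borel_measurable_history)

text \<open>Conditioning on the first \<open>m\<close> stages: the last kernel is split off the law
  of the first \<open>Suc m\<close> stages, and the remaining integral is lifted back to
  plays.\<close>

lemma nn_integral_play_stage:
  fixes f :: "'k \<times> 'i \<times> 'j \<Rightarrow> ennreal"
  shows "(\<integral>\<^sup>+\<omega>. f (\<omega> m) \<partial>P) = (\<integral>\<^sup>+\<omega>. \<integral>\<^sup>+x. f x \<partial>stage_pmf q k \<sigma> \<tau> m \<omega> \<partial>P)"
proof -
  let ?K = "\<lambda>m \<omega>. measure_pmf (stage_pmf q k \<sigma> \<tau> m \<omega>)"
  let ?C = "\<lambda>m. IT.C 0 m (\<lambda>_. undefined)"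
  have [simp]: "(\<lambda>_. undefined) \<in> space (PiM {} N)"
    by (simp add: space_PiM)
  have sets_C: "sets (?C m) = sets (PiM {0..<m} N)" for m
    using IT.sets_C[of "\<lambda>_. undefined" 0 m] by simp
  have space_C: "space (?C m) = space (PiM {0..<m} N)" for m
    using sets_C by (rule sets_eq_imp_space_eq)
  have "(\<integral>\<^sup>+\<omega>. f (\<omega> m) \<partial>P) = (\<integral>\<^sup>+\<omega>. f (restrict \<omega> {0..<Suc m} m) \<partial>P)"
    by simp
  also have "\<dots> = (\<integral>\<^sup>+\<omega>. f (\<omega> m) \<partial>?C (Suc m))"
    by (rule nn_integral_play_history)
  also have "\<dots> = (\<integral>\<^sup>+\<omega>. \<integral>\<^sup>+\<omega>'. f (\<omega>' m) \<partial>IT.eP m \<omega> \<partial>?C m)"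
    unfolding IT.C.simps add_0
    by (rule nn_integral_bind[where B = "PiM {0..<Suc m} N"])
      (auto intro: borel_measurable_history IT.measurable_eP simp: sets_C cong: measurable_cong_sets)
  also have "\<dots> = (\<integral>\<^sup>+\<omega>. \<integral>\<^sup>+x. f x \<partial>?K m \<omega> \<partial>?C m)"
    by (rule nn_integral_cong)
      (subst IT.nn_integral_eP, auto simp: space_C intro: borel_measurable_history)
  also have "\<dots> = (\<integral>\<^sup>+\<omega>. \<integral>\<^sup>+x. f x \<partial>?K m (restrict \<omega> {0..<m}) \<partial>P)"
    by (rule nn_integral_play_history[symmetric])
  \<comment> \<open>The kernel of stage \<open>m\<close> reads only earlier coordinates, so the
    restriction may be dropped.\<close>
  also have "\<dots> = (\<integral>\<^sup>+\<omega>. \<integral>\<^sup>+x. f x \<partial>?K m \<omega> \<partial>P)"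
    by (intro nn_integral_cong) (subst stage_pmf_cong[where \<omega>' = "_ :: nat \<Rightarrow> _"], auto)
  finally show ?thesis .
qed

lemma borel_measurable_play_history:
  fixes f :: "(nat \<Rightarrow> 'k \<times> 'i \<times> 'j) \<Rightarrow> real"
  assumes "\<And>\<omega>. f \<omega> = f (restrict \<omega> {0..<m})"
  shows "f \<in> borel_measurable P"
proof -
  have "(\<lambda>\<omega>. f (restrict \<omega> {0..<m})) \<in> borel_measurable P"
    by (rule measurable_compose[OF measurable_restrict_play borel_measurable_history])
  moreover have "f \<in> borel_measurable P \<longleftrightarrow> (\<lambda>\<omega>. f (restrict \<omega> {0..<m})) \<in> borel_measurable P"
    by (rule measurable_cong) (rule assms)
  ultimately show ?thesis by (simp only:)
qed

lemma borel_measurable_play_stage: "(\<lambda>\<omega>. f (\<omega> m) :: real) \<in> borel_measurable P"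
  by (rule borel_measurable_play_history[of _ "Suc m"]) simp

lemma borel_measurable_stage_expectation:
  "(\<lambda>\<omega>. \<integral>x. f x \<partial>stage_pmf q k \<sigma> \<tau> m \<omega> :: real) \<in> borel_measurable P"
proof (rule borel_measurable_play_history[of _ m])
  fix \<omega> :: "nat \<Rightarrow> 'k \<times> 'i \<times> 'j"
  have "stage_pmf q k \<sigma> \<tau> m \<omega> = stage_pmf q k \<sigma> \<tau> m (restrict \<omega> {0..<m})"
    by (rule stage_pmf_cong) simp
  then show "(\<integral>x. f x \<partial>stage_pmf q k \<sigma> \<tau> m \<omega>) = (\<integral>x. f x \<partial>stage_pmf q k \<sigma> \<tau> m (restrict \<omega> {0..<m}))"
    by simp
qed

lemma abs_le_sum_abs: "\<bar>f x\<bar> \<le> (\<Sum>x\<in>UNIV. \<bar>f x\<bar>)" for f :: "'x::finite \<Rightarrow> real"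
  by (rule member_le_sum) auto

lemma integrable_play_stage: "integrable P (\<lambda>\<omega>. f (\<omega> m) :: real)"
  by (rule play.integrable_const_bound[of _ "\<Sum>x\<in>UNIV. \<bar>f x\<bar>"])
    (auto simp: abs_le_sum_abs borel_measurable_play_stage)

lemma integrable_stage_expectation:
  "integrable P (\<lambda>\<omega>. \<integral>x. f x \<partial>stage_pmf q k \<sigma> \<tau> m \<omega> :: real)"
proof (rule play.integrable_const_bound[of _ "\<Sum>x\<in>UNIV. \<bar>f x\<bar>"])
  have "\<bar>\<integral>x. f x \<partial>measure_pmf p\<bar> \<le> (\<Sum>x\<in>UNIV. \<bar>f x\<bar>)" for p
  proof -
    have "\<bar>\<integral>x. f x \<partial>measure_pmf p\<bar> \<le> (\<Sum>x\<in>UNIV. \<bar>f x * pmf p x\<bar>)"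
      by (subst integral_measure_pmf_real[of UNIV]) (auto intro: sum_abs)
    also have "\<dots> \<le> (\<Sum>x\<in>UNIV. \<bar>f x\<bar>)"
      by (intro sum_mono) (auto simp: abs_mult pmf_le_1 intro!: mult_left_le)
    finally show ?thesis .
  qed
  then show "AE \<omega> in P. norm (\<integral>x. f x \<partial>stage_pmf q k \<sigma> \<tau> m \<omega>) \<le> (\<Sum>x\<in>UNIV. \<bar>f x\<bar>)"
    by simp
qed (rule borel_measurable_stage_expectation)

lemma expectation_play_stage:
  fixes f :: "'k \<times> 'i \<times> 'j \<Rightarrow> real"
  shows "(\<integral>\<omega>. f (\<omega> m) \<partial>P) = (\<integral>\<omega>. \<integral>x. f x \<partial>stage_pmf q k \<sigma> \<tau> m \<omega> \<partial>P)"
proof -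
  have nonneg: "(\<integral>\<omega>. h (\<omega> m) \<partial>P) = (\<integral>\<omega>. \<integral>x. h x \<partial>stage_pmf q k \<sigma> \<tau> m \<omega> \<partial>P)"
    if h: "\<And>x. h x \<ge> 0" for h :: "'k \<times> 'i \<times> 'j \<Rightarrow> real"
  proof -
    have "(\<integral>\<omega>. h (\<omega> m) \<partial>P) = enn2real (\<integral>\<^sup>+\<omega>. ennreal (h (\<omega> m)) \<partial>P)"
      by (rule integral_eq_nn_integral) (auto simp: h borel_measurable_play_stage)
    also have "(\<integral>\<^sup>+\<omega>. ennreal (h (\<omega> m)) \<partial>P) =
        (\<integral>\<^sup>+\<omega>. \<integral>\<^sup>+x. ennreal (h x) \<partial>stage_pmf q k \<sigma> \<tau> m \<omega> \<partial>P)"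
      by (rule nn_integral_play_stage)
    also have "\<dots> = (\<integral>\<^sup>+\<omega>. ennreal (\<integral>x. h x \<partial>stage_pmf q k \<sigma> \<tau> m \<omega>) \<partial>P)"
      by (intro nn_integral_cong nn_integral_eq_integral)
        (auto simp: h intro: integrable_measure_pmf_finite)
    also have "enn2real \<dots> = (\<integral>\<omega>. \<integral>x. h x \<partial>stage_pmf q k \<sigma> \<tau> m \<omega> \<partial>P)"
      by (rule integral_eq_nn_integral[symmetric])
        (auto simp: h borel_measurable_stage_expectation)
    finally show ?thesis .
  qed
  \<comment> \<open>Adding \<open>B\<close> makes the function nonnegative and reduces the claim to
    the nonnegative case.\<close>
  define B where "B = (\<Sum>x\<in>UNIV. \<bar>f x\<bar>)"
  have "f x + B \<ge> 0" for x
    using abs_le_sum_abs[of f x] unfolding B_def by linarith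
  then have "(\<integral>\<omega>. f (\<omega> m) + B \<partial>P) = (\<integral>\<omega>. \<integral>x. f x + B \<partial>stage_pmf q k \<sigma> \<tau> m \<omega> \<partial>P)"
    by (rule nonneg)
  moreover have "(\<integral>\<omega>. f (\<omega> m) + B \<partial>P) = (\<integral>\<omega>. f (\<omega> m) \<partial>P) + B"
    by (subst Bochner_Integration.integral_add) (auto simp: integrable_play_stage play.prob_space)
  moreover have "(\<integral>x. f x + B \<partial>measure_pmf p) = (\<integral>x. f x \<partial>measure_pmf p) + B" for p
    by (subst Bochner_Integration.integral_add) (auto intro: integrable_measure_pmf_finite)
  moreover have "(\<integral>\<omega>. (\<integral>x. f x \<partial>stage_pmf q k \<sigma> \<tau> m \<omega>) + B \<partial>P) =
      (\<integral>\<omega>. \<integral>x. f x \<partial>stage_pmf q k \<sigma> \<tau> m \<omega> \<partial>P) + B"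
    by (subst Bochner_Integration.integral_add)
      (auto simp: integrable_stage_expectation play.prob_space)
  ultimately show ?thesis by simp
qed

lemma expectation_stage_pmf:
  fixes f :: "'k \<times> 'i \<times> 'j \<Rightarrow> real"
  shows "(\<integral>x. f x \<partial>stage_pmf q k \<sigma> \<tau> m \<omega>) =
    (\<Sum>l\<in>UNIV. pmf (state_pmf q k m \<omega>) l * (\<Sum>i\<in>UNIV. \<Sum>j\<in>UNIV.
      pmf (\<sigma> (map \<omega> [0..<m]) l) i * pmf (\<tau> (map \<omega> [0..<m]) l) j * f (l, i, j)))"
proof -
  have "(\<integral>x. f (l, x) \<partial>pair_pmf s t) = (\<Sum>i\<in>UNIV. \<Sum>j\<in>UNIV. pmf s i * pmf t j * f (l, i, j))"
    for l s t
  proof -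
    have "(\<integral>x. f (l, x) \<partial>pair_pmf s t) = (\<Sum>x\<in>UNIV \<times> UNIV. f (l, x) * pmf (pair_pmf s t) x)"
      by (subst integral_measure_pmf_real[of UNIV]) auto
    also have "\<dots> = (\<Sum>(i, j)\<in>UNIV \<times> UNIV. pmf s i * pmf t j * f (l, i, j))"
      by (intro sum.cong) (auto simp: pmf_pair)
    also have "\<dots> = (\<Sum>i\<in>UNIV. \<Sum>j\<in>UNIV. pmf s i * pmf t j * f (l, i, j))"
      by (rule sum.cartesian_product[symmetric])
    finally show ?thesis .
  qed
  then show ?thesis
    unfolding stage_pmf_def by (subst pmf_expectation_bind[of UNIV]) auto
qed

text \<open>Under the local inequalities the discounted payoff up to stage \<open>M\<close>, completed by the
  discounted value \<open>u\<close> of the current state, is a supermartingale.\<close>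
lemma discounted_payoff_le:
  fixes g :: "('k, 'i, 'j) reward" and u :: "'k \<Rightarrow> real"
  assumes lam: "0 \<le> lam" "lam \<le> 1"
    and u: "\<And>h l. (\<Sum>i\<in>UNIV. \<Sum>j\<in>UNIV. pmf (\<sigma> h l) i * pmf (\<tau> h l) j *
      (lam * g l i j + (1 - lam) * (\<Sum>l'\<in>UNIV. pmf (q l i j) l' * u l'))) \<le> u l"
  shows "(\<Sum>m<M. lam * (1 - lam) ^ m * (\<integral>\<omega>. stage_reward g \<omega> m \<partial>P)) +
    (1 - lam) ^ M * (\<integral>\<omega>. u (fst (\<omega> M)) \<partial>P) \<le> u k"
proof -
  define G where "G = (\<lambda>(l, i, j). g l i j)"
  define U where "U = (\<lambda>(l, i, j). \<Sum>l'\<in>UNIV. pmf (q l i j) l' * u l')"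
  let ?u = "\<lambda>m. \<integral>\<omega>. u (fst (\<omega> m)) \<partial>P"
  have reward: "stage_reward g \<omega> m = G (\<omega> m)" for \<omega> m
    by (simp add: stage_reward_def G_def)
  have exp_u: "(\<integral>x. u (fst x) \<partial>stage_pmf q k \<sigma> \<tau> m \<omega>) =
      (\<Sum>l\<in>UNIV. pmf (state_pmf q k m \<omega>) l * u l)" for m \<omega>
  proof -
    have "(\<Sum>i\<in>UNIV. \<Sum>j\<in>UNIV. pmf s i * pmf t j * c) = c" for s :: "'i pmf" and t :: "'j pmf" and c
      by (simp add: sum_pmf_eq_1 flip: sum_distrib_left sum_distrib_right)
    then show ?thesis by (simp add: expectation_stage_pmf)
  qed
  have "?u 0 = (\<integral>\<omega>. u k \<partial>P)"
    unfolding expectation_play_stage[of "\<lambda>x. u (fst x)"] exp_u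
    by (simp add: indicator_def if_distrib[of "\<lambda>x. x * _"] cong: if_cong)
  then have u0: "?u 0 = u k" by (simp add: play.prob_space)
  \<comment> \<open>Given the triple of stage \<open>m\<close>, the next state is drawn from
    \<open>q\<close>, so \<open>U\<close> is the conditional mean of the next
    \<open>u\<close>.\<close>
  have uSuc: "?u (Suc m) = (\<integral>\<omega>. U (\<omega> m) \<partial>P)" for m
    unfolding expectation_play_stage[of "\<lambda>x. u (fst x)"] exp_u
    by (simp add: U_def case_prod_beta)
  have step: "lam * (\<integral>\<omega>. G (\<omega> m) \<partial>P) + (1 - lam) * ?u (Suc m) \<le> ?u m" for m
  proof -
    have "lam * (\<integral>\<omega>. G (\<omega> m) \<partial>P) + (1 - lam) * ?u (Suc m) =
        (\<integral>\<omega>. lam * G (\<omega> m) + (1 - lam) * U (\<omega> m) \<partial>P)"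
      unfolding uSuc by (subst Bochner_Integration.integral_add) (auto intro: integrable_play_stage)
    also have "\<dots> = (\<integral>\<omega>. \<integral>x. lam * G x + (1 - lam) * U x \<partial>stage_pmf q k \<sigma> \<tau> m \<omega> \<partial>P)"
      by (rule expectation_play_stage)
    also have "\<dots> \<le> (\<integral>\<omega>. \<integral>x. u (fst x) \<partial>stage_pmf q k \<sigma> \<tau> m \<omega> \<partial>P)"
    proof (rule integral_mono)
      show "(\<integral>x. lam * G x + (1 - lam) * U x \<partial>stage_pmf q k \<sigma> \<tau> m \<omega>) \<le>
          (\<integral>x. u (fst x) \<partial>stage_pmf q k \<sigma> \<tau> m \<omega>)" for \<omega>
        unfolding exp_u expectation_stage_pmf
        by (intro sum_mono mult_left_mono) (auto simp: G_def U_def u)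
    qed (rule integrable_stage_expectation)+
    also have "\<dots> = ?u m" by (rule expectation_play_stage[symmetric])
    finally show ?thesis .
  qed
  have "(\<Sum>m<M. lam * (1 - lam) ^ m * (\<integral>\<omega>. G (\<omega> m) \<partial>P)) + (1 - lam) ^ M * ?u M \<le> u k"
  proof (induction M)
    case 0
    then show ?case by (simp add: u0)
  next
    case (Suc M)
    \<comment> \<open>Weighted by \<open>(1 - lam) ^ M\<close>, the one-step inequalities
      telescope.\<close>
    have "(1 - lam) ^ M * (lam * (\<integral>\<omega>. G (\<omega> M) \<partial>P) + (1 - lam) * ?u (Suc M)) \<le> (1 - lam) ^ M * ?u M"
      using lam by (intro mult_left_mono step) auto
    then show ?case using Suc by (simp add: algebra_simps)
  qed
  then show ?thesis by (simp add: reward)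
qed

lemma expectation_avg_reward:
  "(\<integral>\<omega>. avg_reward g M \<omega> \<partial>P) = (\<Sum>m<M. \<integral>\<omega>. stage_reward g \<omega> m \<partial>P) / real M"
proof -
  have "integrable P (\<lambda>\<omega>. stage_reward g \<omega> m)" for m
    unfolding stage_reward_def by (rule integrable_play_stage)
  then show ?thesis by (simp add: avg_reward_def)
qed

lemma abs_expectation_play_stage_le:
  fixes f :: "'k \<times> 'i \<times> 'j \<Rightarrow> real"
  assumes "\<And>x. \<bar>f x\<bar> \<le> G"
  shows "\<bar>\<integral>\<omega>. f (\<omega> m) \<partial>P\<bar> \<le> G"
proof -
  have "\<bar>\<integral>\<omega>. f (\<omega> m) \<partial>P\<bar> \<le> (\<integral>\<omega>. \<bar>f (\<omega> m)\<bar> \<partial>P)"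
    using integral_norm_bound[of P "\<lambda>\<omega>. f (\<omega> m)"] by simp
  also have "\<dots> \<le> (\<integral>\<omega>. G \<partial>P)"
    using assms by (intro integral_mono integrable_play_stage[of "\<lambda>x. \<bar>f x\<bar>"]) auto
  finally show ?thesis by (simp add: play.prob_space)
qed

end


section \<open>The value as the sign change of F\<close>

lemma abel_weighted_sum_ge:
  fixes w b :: "nat \<Rightarrow> real"
  assumes w: "\<And>m. w (Suc m) \<le> w m" and b: "\<And>M. (\<Sum>m<M. b m) \<ge> - C"
    and wN: "w N \<ge> 0"
  shows "(\<Sum>m<N. w m * b m) \<ge> - C * w 0"
proof -
  \<comment> \<open>Summation by parts: each drop of the weight multiplies a partial sum that is at
    least \<open>- C\<close>, and the drops add up to \<open>w 0 - w N\<close>.\<close>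
  have "(\<Sum>m<N. w m * b m) \<ge> w N * (\<Sum>m<N. b m) - C * (w 0 - w N)" for N
  proof (induction N)
    case (Suc N)
    have "w (Suc N) * ((\<Sum>m<Suc N. b m) + C) \<le> w N * ((\<Sum>m<Suc N. b m) + C)"
      using b[of "Suc N"] w by (intro mult_right_mono) auto
    with Suc show ?case by (simp add: algebra_simps)
  qed simp
  from this[of N] have "(\<Sum>m<N. w m * b m) \<ge> w N * (\<Sum>m<N. b m) - C * w 0 + w N * C"
    by (simp add: algebra_simps)
  moreover have "w N * (\<Sum>m<N. b m) \<ge> - (w N * C)"
    using mult_left_mono[OF b wN] by simp
  ultimately show ?thesis by simp
qed

text \<open>The partial sums of \<open>a m - c\<close> are bounded below, and the discount weights
  decrease from \<open>lam\<close>, so summation by parts loses at most \<open>lam\<close> times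
  that bound.\<close>

lemma cesaro_bound_imp_discounted_bound:
  fixes a :: "nat \<Rightarrow> real"
  assumes lam: "0 < lam" "lam \<le> 1"
    and a: "\<And>m. \<bar>a m\<bar> \<le> G" and cesaro: "\<And>M. M \<ge> M0 \<Longrightarrow> c * real M \<le> (\<Sum>m<M. a m)"
    and disc: "\<And>N. (\<Sum>m<N. lam * (1 - lam) ^ m * a m) - (1 - lam) ^ N * G \<le> U"
  shows "c - lam * (real M0 * (G + \<bar>c\<bar>)) \<le> U"
proof -
  \<comment> \<open>\<open>C\<close> is the largest deficit that can build up before stage
    \<open>M0\<close>, at most \<open>G + \<bar>c\<bar>\<close> per stage; from \<open>M0\<close> on
    the partial sums are nonnegative.\<close>
  define C where "C = real M0 * (G + \<bar>c\<bar>)"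
  have "G \<ge> 0" using a[of 0] by linarith
  have partial: "(\<Sum>m<M. a m - c) \<ge> - C" for M
  proof (cases "M \<ge> M0")
    case True
    have "C \<ge> 0" using \<open>G \<ge> 0\<close> by (simp add: C_def)
    then show ?thesis using cesaro[OF True] by (simp add: sum_subtractf mult.commute)
  next
    case False
    have "(\<Sum>m<M. a m - c) \<ge> (\<Sum>m<M. - (G + \<bar>c\<bar>))"
    proof (rule sum_mono)
      show "- (G + \<bar>c\<bar>) \<le> a m - c" for m using a[of m] by linarith
    qed
    moreover have "real M * (G + \<bar>c\<bar>) \<le> C"
      unfolding C_def using False \<open>G \<ge> 0\<close> by (intro mult_right_mono) auto
    ultimately show ?thesis by (simp add: algebra_simps)
  qed
  have geom: "(\<Sum>m<N. lam * (1 - lam) ^ m) = 1 - (1 - lam) ^ N" for N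
    by (induction N) (auto simp: algebra_simps)
  have ineq: "c * (1 - (1 - lam) ^ N) - lam * C - (1 - lam) ^ N * G \<le> U" for N
  proof -
    have "(\<Sum>m<N. (1 - lam) ^ m * (a m - c)) \<ge> - C * (1 - lam) ^ 0"
      using lam by (intro abel_weighted_sum_ge partial) (auto intro: mult_left_le_one_le)
    then have "lam * (\<Sum>m<N. (1 - lam) ^ m * (a m - c)) \<ge> lam * (- C)"
      using lam by (intro mult_left_mono) auto
    also have "lam * (\<Sum>m<N. (1 - lam) ^ m * (a m - c)) =
        (\<Sum>m<N. lam * (1 - lam) ^ m * a m) - c * (\<Sum>m<N. lam * (1 - lam) ^ m)"
      by (simp add: sum_distrib_left sum_subtractf[symmetric] algebra_simps)
    finally show ?thesis using disc[of N] by (simp add: geom)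
  qed
  \<comment> \<open>Letting the horizon tend to infinity removes the terminal term and the missing
    discount mass.\<close>
  have "(\<lambda>N. (1 - lam) ^ N) \<longlonglongrightarrow> 0"
    using lam by (intro LIMSEQ_power_zero) auto
  then have "(\<lambda>N. c * (1 - (1 - lam) ^ N) - lam * C - (1 - lam) ^ N * G) \<longlonglongrightarrow>
      c * (1 - 0) - lam * C - 0 * G"
    by (intro tendsto_diff tendsto_mult tendsto_const)
  then have "c * (1 - 0) - lam * C - 0 * G \<le> U"
    by (rule LIMSEQ_le_const2) (use ineq in auto)
  then show ?thesis by (simp add: C_def)
qed

lemma sum_pmf_pmf_le:
  fixes s :: "'i::finite pmf" and t :: "'j::finite pmf"
  assumes "\<And>i. (\<Sum>j\<in>UNIV. pmf t j * h i j) \<le> c"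
  shows "(\<Sum>i\<in>UNIV. \<Sum>j\<in>UNIV. pmf s i * pmf t j * h i j) \<le> c"
proof -
  have "(\<Sum>i\<in>UNIV. \<Sum>j\<in>UNIV. pmf s i * pmf t j * h i j) =
      (\<Sum>i\<in>UNIV. pmf s i * (\<Sum>j\<in>UNIV. pmf t j * h i j))"
    by (simp add: sum_distrib_left mult_ac)
  also have "\<dots> \<le> (\<Sum>i\<in>UNIV. pmf s i * c)"
    by (intro sum_mono mult_left_mono assms) auto
  finally show ?thesis by (simp flip: sum_distrib_right)
qed

lemma reward_bounded:
  fixes g :: "('k::finite, 'i::finite, 'j::finite) reward"
  obtains G where "\<And>l i j. \<bar>g l i j\<bar> \<le> G"
proof
  show "\<bar>g l i j\<bar> \<le> (\<Sum>x\<in>UNIV. \<bar>case x of (l, i, j) \<Rightarrow> g l i j\<bar>)" for l i j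
    using abs_le_sum_abs[of "\<lambda>(l, i, j). g l i j" "(l, i, j)"] by simp
qed

lemma discounted_value_le:
  fixes g :: "('k::finite, 'i::finite, 'j::finite) reward" and q :: "('k, 'i, 'j) transition"
  assumes G: "\<And>l i j. \<bar>g l i j\<bar> \<le> G"
    and lam: "0 < lam" "lam \<le> 1" and uG: "\<And>l. \<bar>u l\<bar> \<le> G"
    and u: "\<And>h l. (\<Sum>i\<in>UNIV. \<Sum>j\<in>UNIV. pmf (\<sigma> h l) i * pmf (\<tau> h l) j *
      (lam * g l i j + (1 - lam) * (\<Sum>l'\<in>UNIV. pmf (q l i j) l' * u l'))) \<le> u l"
    and c: "\<And>M. M \<ge> M0 \<Longrightarrow> c \<le> (\<integral>\<omega>. avg_reward g M \<omega> \<partial>play_measure q k \<sigma> \<tau>)"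
  shows "c - lam * (real M0 * (G + \<bar>c\<bar>)) \<le> u k"
proof (rule cesaro_bound_imp_discounted_bound[OF lam])
  let ?a = "\<lambda>m. \<integral>\<omega>. stage_reward g \<omega> m \<partial>play_measure q k \<sigma> \<tau>"
  show "\<bar>?a m\<bar> \<le> G" for m
    unfolding stage_reward_def by (rule abs_expectation_play_stage_le) (use G in auto)
  show "c * real M \<le> (\<Sum>m<M. ?a m)" if "M \<ge> M0" for M
    using c[OF that] by (cases "M = 0") (auto simp: expectation_avg_reward field_simps)
  show "(\<Sum>m<N. lam * (1 - lam) ^ m * ?a m) - (1 - lam) ^ N * G \<le> u k" for N
  proof -
    \<comment> \<open>The continuation value in the supermartingale bound is at least
      \<open>- G\<close>, which yields the terminal term.\<close>
    have "\<bar>\<integral>\<omega>. u (fst (\<omega> N)) \<partial>play_measure q k \<sigma> \<tau>\<bar> \<le> G"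
      by (rule abs_expectation_play_stage_le[of "\<lambda>x. u (fst x)"]) (rule uG)
    then have "(1 - lam) ^ N * (- G) \<le> (1 - lam) ^ N * (\<integral>\<omega>. u (fst (\<omega> N)) \<partial>play_measure q k \<sigma> \<tau>)"
      using lam by (intro mult_left_mono) (auto simp: abs_le_iff)
    then show ?thesis
      using discounted_payoff_le[where k = k and q = q and g = g and M = N and \<sigma> = \<sigma> and \<tau> = \<tau>, OF _ _ u] lam
      by simp
  qed
qed

context
  fixes g :: "('k::finite, 'i::finite, 'j::finite) reward" and q :: "('k, 'i, 'j) transition"
    and k :: 'k and G :: real
  assumes G: "\<And>l i j. \<bar>g l i j\<bar> \<le> G"
begin

text \<open>The guarantee of \<open>\<sigma>\<close> is tested against the stationary reply
  \<open>y\<close>, under which the local inequalities hold after every history and cap the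
  discounted payoff at \<open>u k\<close>.\<close>

lemma stationary_reply_ge:
  assumes lam: "0 < lam" "lam \<le> 1" and uG: "\<And>l. \<bar>u l\<bar> \<le> G"
    and y: "\<And>l i. u l \<ge> (\<Sum>j\<in>UNIV. pmf (y l) j *
      (lam * g l i j + (1 - lam) * (\<Sum>l'\<in>UNIV. pmf (q l i j) l' * u l')))"
    and \<sigma>: "\<And>\<tau> M. M \<ge> M0 \<Longrightarrow> c \<le> (\<integral>\<omega>. avg_reward g M \<omega> \<partial>play_measure q k \<sigma> \<tau>)"
  shows "c - lam * (real M0 * (G + \<bar>c\<bar>)) \<le> u k"
  by (rule discounted_value_le[OF G lam uG, where \<sigma> = \<sigma> and \<tau> = "\<lambda>_. y"])
    (use \<sigma> in \<open>auto intro: sum_pmf_pmf_le y\<close>)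

text \<open>Negating \<open>g\<close> and \<open>u\<close> keeps the law of the play and turns
  Player 2's upper guarantee into a lower one, so the supermartingale argument is reused.\<close>

lemma stationary_reply_le:
  assumes lam: "0 < lam" "lam \<le> 1" and uG: "\<And>l. \<bar>u l\<bar> \<le> G"
    and x: "\<And>l j. u l \<le> (\<Sum>i\<in>UNIV. pmf (x l) i *
      (lam * g l i j + (1 - lam) * (\<Sum>l'\<in>UNIV. pmf (q l i j) l' * u l')))"
    and \<tau>: "\<And>\<sigma> M. M \<ge> M0 \<Longrightarrow> (\<integral>\<omega>. avg_reward g M \<omega> \<partial>play_measure q k \<sigma> \<tau>) \<le> c"
  shows "u k \<le> c + lam * (real M0 * (G + \<bar>c\<bar>))"
proof -
  have "- c - lam * (real M0 * (G + \<bar>- c\<bar>)) \<le> - u k"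
  proof (rule discounted_value_le[where g = "\<lambda>l i j. - g l i j" and u = "\<lambda>l. - u l"
        and \<sigma> = "\<lambda>_. x" and \<tau> = \<tau>, OF _ lam])
    have avg: "avg_reward (\<lambda>l i j. - g l i j) M \<omega> = - avg_reward g M \<omega>" for M \<omega>
      by (simp add: avg_reward_def stage_reward_def case_prod_beta sum_negf)
    show "- c \<le> (\<integral>\<omega>. avg_reward (\<lambda>l i j. - g l i j) M \<omega> \<partial>play_measure q k (\<lambda>_. x) \<tau>)"
      if "M \<ge> M0" for M
      using \<tau>[OF that] by (simp add: avg)
    show "(\<Sum>i\<in>UNIV. \<Sum>j\<in>UNIV. pmf (x l) i * pmf (\<tau> h l) j *
        (lam * - g l i j + (1 - lam) * (\<Sum>l'\<in>UNIV. pmf (q l i j) l' * - u l'))) \<le> - u l" for h l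
    \<comment> \<open>The average over \<open>x\<close> has to become the inner sum, since the local
      inequality holds for each fixed action of Player 2.\<close>
    proof (subst sum.swap, subst mult.commute[of "pmf (x l) _"], rule sum_pmf_pmf_le)
      show "(\<Sum>i\<in>UNIV. pmf (x l) i *
          (lam * - g l i j + (1 - lam) * (\<Sum>l'\<in>UNIV. pmf (q l i j) l' * - u l'))) \<le> - u l" for j
      proof -
        have "lam * - g l i j + (1 - lam) * (\<Sum>l'\<in>UNIV. pmf (q l i j) l' * - u l') =
            - (lam * g l i j + (1 - lam) * (\<Sum>l'\<in>UNIV. pmf (q l i j) l' * u l'))" for i
          by (simp add: sum_negf)
        then show ?thesis using x[of l j] by (simp only: mult_minus_right sum_negf neg_le_iff_le)
      qed
    qed
  qed (use G uG in auto)
  then show ?thesis by simp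
qed

section \<open>Slope and sign change of F\<close>

lemma matrix_val_W_decreasing:
  assumes "0 \<le> lam" "lam \<le> 1" "z \<le> z'"
  shows "matrix_val (W g q k lam z') + (z' - z) * lam ^ CARD('k) \<le> matrix_val (W g q k lam z)"
proof (rule matrix_val_add_le)
  fix i j
  have "(z' - z) * lam ^ CARD('k) \<le> (z' - z) * det0 q lam i j"
    using assms by (intro mult_left_mono det0_ge_power) auto
  then show "W g q k lam z' $ i $ j + (z' - z) * lam ^ CARD('k) \<le> W g q k lam z $ i $ j"
    by (simp add: W_def algebra_simps)
qed

lemma matrix_val_W_quot_decreasing:
  assumes "0 < lam" "lam \<le> 1" "z \<le> z'"
  shows "matrix_val (W g q k lam z') / lam ^ CARD('k) + (z' - z) \<le> matrix_val (W g q k lam z) / lam ^ CARD('k)"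
proof -
  have "(matrix_val (W g q k lam z') + (z' - z) * lam ^ CARD('k)) / lam ^ CARD('k) \<le>
      matrix_val (W g q k lam z) / lam ^ CARD('k)"
    using assms by (intro divide_right_mono matrix_val_W_decreasing) auto
  then show ?thesis using assms by (simp add: add_divide_distrib)
qed

lemma W_quot_tendsto_F: "(W_quot g q k z \<longlongrightarrow> F g q k z) (at_right 0)"
  using W_quot_converges[of g q k z] unfolding F_def by (metis tendsto_Lim trivial_limit_at_right_real)

lemma eventually_small: "\<forall>\<^sub>F lam in at_right 0. 0 < lam \<and> lam < (1::real)"
  using eventually_at_right_real[of 0 "1::real"] by simp

lemma F_ge:
  assumes "\<forall>\<^sub>F lam in at_right 0. c \<le> matrix_val (W g q k lam z) / lam ^ CARD('k)"
  shows "ereal c \<le> F g q k z"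
  by (rule tendsto_lowerbound[OF W_quot_tendsto_F])
    (use assms in \<open>auto simp: W_quot_def elim!: eventually_mono\<close>)

lemma F_le:
  assumes "\<forall>\<^sub>F lam in at_right 0. matrix_val (W g q k lam z) / lam ^ CARD('k) \<le> c"
  shows "F g q k z \<le> ereal c"
  by (rule tendsto_upperbound[OF W_quot_tendsto_F])
    (use assms in \<open>auto simp: W_quot_def elim!: eventually_mono\<close>)

text \<open>As \<open>F\<close> may be infinite, the slope bound is used before the limit: half of
  the gap \<open>z' - z\<close> absorbs the error of approximating the limit, and the other half
  bounds \<open>F g q k z\<close> from below.\<close>

lemma F_pos_if_nonneg_right:
  assumes "z < z'" "F g q k z' \<ge> 0"
  shows "F g q k z > 0"
proof -
  define d where "d = (z' - z) / 2"
  have d: "d > 0" using assms(1) by (simp add: d_def)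
  then have "ereal (- d) < F g q k z'"
    using assms(2) by (auto intro: less_le_trans[of _ 0])
  from order_tendstoD(1)[OF W_quot_tendsto_F this] eventually_small
  have "\<forall>\<^sub>F lam in at_right 0. d \<le> matrix_val (W g q k lam z) / lam ^ CARD('k)"
  proof eventually_elim
    case (elim lam)
    then have "- d < matrix_val (W g q k lam z') / lam ^ CARD('k)"
      by (simp add: W_quot_def)
    moreover have "matrix_val (W g q k lam z') / lam ^ CARD('k) + (z' - z) \<le>
        matrix_val (W g q k lam z) / lam ^ CARD('k)"
      using elim assms(1) by (intro matrix_val_W_quot_decreasing) auto
    moreover have "z' - z = 2 * d" by (simp add: d_def)
    ultimately show ?case by linarith
  qed
  then have "ereal d \<le> F g q k z" by (rule F_ge)
  then show ?thesis using d by (simp add: less_le_trans[of 0 "ereal d"])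
qed

lemma F_neg_if_nonpos_left:
  assumes "z' < z" "F g q k z' \<le> 0"
  shows "F g q k z < 0"
proof -
  define d where "d = (z - z') / 2"
  have d: "d > 0" using assms(1) by (simp add: d_def)
  then have "F g q k z' < ereal d"
    using assms(2) by (auto intro: le_less_trans[of _ 0])
  from order_tendstoD(2)[OF W_quot_tendsto_F this] eventually_small
  have "\<forall>\<^sub>F lam in at_right 0. matrix_val (W g q k lam z) / lam ^ CARD('k) \<le> - d"
  proof eventually_elim
    case (elim lam)
    then have "matrix_val (W g q k lam z') / lam ^ CARD('k) < d"
      by (simp add: W_quot_def)
    moreover have "matrix_val (W g q k lam z) / lam ^ CARD('k) + (z - z') \<le>
        matrix_val (W g q k lam z') / lam ^ CARD('k)"
      using elim assms(1) by (intro matrix_val_W_quot_decreasing) auto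
    moreover have "z - z' = 2 * d" by (simp add: d_def)
    ultimately show ?case by linarith
  qed
  then have "F g q k z \<le> ereal (- d)" by (rule F_le)
  then show ?thesis using d by (simp add: le_less_trans[of _ "ereal (- d)" 0])
qed

lemma F_nonneg:
  assumes "\<forall>\<^sub>F lam in at_right 0. matrix_val (W g q k lam z) \<ge> 0"
  shows "F g q k z \<ge> 0"
proof -
  from assms eventually_small
  have "\<forall>\<^sub>F lam in at_right 0. 0 \<le> matrix_val (W g q k lam z) / lam ^ CARD('k)"
    by eventually_elim simp
  then show ?thesis using F_ge[of 0 z] by (simp add: zero_ereal_def)
qed

lemma F_nonpos:
  assumes "\<forall>\<^sub>F lam in at_right 0. matrix_val (W g q k lam z) \<le> 0"
  shows "F g q k z \<le> 0"
proof -
  from assms eventually_small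
  have "\<forall>\<^sub>F lam in at_right 0. matrix_val (W g q k lam z) / lam ^ CARD('k) \<le> 0"
    by eventually_elim (simp add: divide_le_0_iff)
  then show ?thesis using F_le[of z 0] by (simp add: zero_ereal_def)
qed

text \<open>The constant vector \<open>- G\<close> is reproduced by averaging over transitions and
  lies below all rewards, so any mixed action meets the local inequality.\<close>

lemma F_at_lower_reward_bound: "F g q k (- G) \<ge> 0"
proof (rule F_nonneg)
  show "\<forall>\<^sub>F lam in at_right 0. matrix_val (W g q k lam (- G)) \<ge> 0"
    using eventually_small
  proof eventually_elim
    case (elim lam)
    have ineq: "- G \<le> (\<Sum>i\<in>UNIV. pmf s i * (lam * g l i j + (1 - lam) * (\<Sum>l'\<in>UNIV. pmf (q l i j) l' * - G)))"
      for l j and s :: "'i pmf"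
    proof -
      have "- G = (\<Sum>i\<in>UNIV. pmf s i * - G)" by (simp only: sum_pmf_mult_const)
      also have "\<dots> \<le> (\<Sum>i\<in>UNIV. pmf s i * (lam * g l i j + (1 - lam) * - G))"
      proof (intro sum_mono mult_left_mono)
        fix i
        have "lam * - G \<le> lam * g l i j" using elim G[of l i j] by (intro mult_left_mono) auto
        then show "- G \<le> lam * g l i j + (1 - lam) * - G" by (simp add: algebra_simps)
      qed auto
      finally show ?thesis by (simp only: sum_pmf_mult_const)
    qed
    then show ?case
      using elim by (intro matrix_val_W_nonneg[where u = "\<lambda>_. - G" and x = "\<lambda>_. return_pmf undefined", OF _ _ ineq]) auto
  qed
qed

lemma F_at_upper_reward_bound: "F g q k G \<le> 0"
proof (rule F_nonpos)
  show "\<forall>\<^sub>F lam in at_right 0. matrix_val (W g q k lam G) \<le> 0"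
    using eventually_small
  proof eventually_elim
    case (elim lam)
    have ineq: "G \<ge> (\<Sum>j\<in>UNIV. pmf t j * (lam * g l i j + (1 - lam) * (\<Sum>l'\<in>UNIV. pmf (q l i j) l' * G)))"
      for l i and t :: "'j pmf"
    proof -
      have "(\<Sum>j\<in>UNIV. pmf t j * (lam * g l i j + (1 - lam) * G)) \<le> (\<Sum>j\<in>UNIV. pmf t j * G)"
      proof (intro sum_mono mult_left_mono)
        fix j
        have "lam * g l i j \<le> lam * G" using elim G[of l i j] by (intro mult_left_mono) auto
        then show "lam * g l i j + (1 - lam) * G \<le> G" by (simp add: algebra_simps)
      qed auto
      also have "\<dots> = G" by (rule sum_pmf_mult_const)
      finally show ?thesis by (simp only: sum_pmf_mult_const)
    qed
    then show ?case
      using elim by (intro matrix_val_W_nonpos[where u = "\<lambda>_. G" and y = "\<lambda>_. return_pmf undefined", OF _ _ ineq]) auto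
  qed
qed

private abbreviation "sign_change w \<equiv>
  \<forall>z. (z > w \<longrightarrow> F g q k z < 0) \<and> (z < w \<longrightarrow> F g q k z > 0)"

lemma sign_change_unique:
  assumes "sign_change w" "sign_change w'"
  shows "w = w'"
proof (rule ccontr)
  assume "w \<noteq> w'"
  then obtain z where "w < z \<and> z < w' \<or> w' < z \<and> z < w"
    using dense by (metis neqE)
  then show False using assms by (metis less_asym)
qed

lemma sign_change_exists: "\<exists>w. sign_change w"
proof (intro exI allI conjI impI)
  \<comment> \<open>The witness \<open>w\<close> is the supremum of this set, which the bounds on
    the reward make nonempty and bounded above.\<close>
  let ?A = "{z. F g q k z > 0}"
  have bdd: "bdd_above ?A"
  proof (rule bdd_aboveI)
    fix z assume "z \<in> ?A"
    then show "z \<le> G"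
      using F_pos_if_nonneg_right[of G z] F_at_upper_reward_bound by (force simp: not_le[symmetric])
  qed
  have "- G - 1 \<in> ?A"
    using F_pos_if_nonneg_right[of "- G - 1" "- G"] F_at_lower_reward_bound by simp
  then have ne: "?A \<noteq> {}" by blast
  fix z
  show "F g q k z < 0" if "z > Sup ?A"
  proof -
    \<comment> \<open>Beyond the supremum \<open>F\<close> is only known not to be positive; the
      intermediate point \<open>y\<close> makes the sign at \<open>z\<close> strict.\<close>
    define y where "y = (z + Sup ?A) / 2"
    have "y > Sup ?A" "y < z" using that by (auto simp: y_def)
    then have "\<not> F g q k y > 0"
      using cSup_upper[OF _ bdd, of y] by auto
    then show ?thesis using F_neg_if_nonpos_left[of y z] \<open>y < z\<close> by (simp add: not_less)
  qed
  show "F g q k z > 0" if lt: "z < Sup ?A"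
  proof -
    obtain y where "y \<in> ?A" "z < y"
      using lt less_cSup_iff[OF ne bdd] by auto
    then show ?thesis using F_pos_if_nonneg_right[of z y] by simp
  qed
qed

lemma eventually_small_error: "d > 0 \<Longrightarrow> \<forall>\<^sub>F lam in at_right 0. lam * C < (d::real)"
proof -
  assume "d > 0"
  have "((\<lambda>lam. lam * C) \<longlongrightarrow> 0 * C) (at_right 0)" by (intro tendsto_intros)
  then show ?thesis using \<open>d > 0\<close> by (intro order_tendstoD(2)[of _ "0 * C"]) auto
qed

text \<open>An equilibrium is chosen separately for each small \<open>lam\<close>, and only the side
  of \<open>z'\<close> on which its \<open>u k\<close> lies is carried to the limit.\<close>

lemma sign_change_game_value:
  assumes v: "is_game_value g q k v"
  shows "sign_change v"
proof (intro allI conjI impI)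
  fix z
  show "F g q k z > 0" if "z < v"
  proof -
    \<comment> \<open>A weak sign at the midpoint \<open>z'\<close> gives a strict one at
      \<open>z\<close>. The distance from \<open>z'\<close> to \<open>v\<close> is
      \<open>2 * e\<close>: one \<open>e\<close> for the guarantee of the strategy, one for the
      error of passing to discounted payoffs.\<close>
    define z' where "z' = (z + v) / 2"
    define e where "e = (v - z') / 2"
    have e: "e > 0" and zz': "z < z'" using that by (auto simp: e_def z'_def)
    obtain M0 \<sigma> where "\<forall>\<tau>. (\<forall>M\<ge>M0.
          v - e \<le> (\<integral>\<omega>. avg_reward g M \<omega> \<partial>play_measure q k \<sigma> \<tau>)) \<and>
        v - e \<le> (\<integral>\<omega>. liminf_reward g \<omega> \<partial>play_measure q k \<sigma> \<tau>)"
      using v[unfolded is_game_value_def, rule_format, OF e] by (elim exE conjE)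
    then have \<sigma>: "v - e \<le> (\<integral>\<omega>. avg_reward g M \<omega> \<partial>play_measure q k \<sigma> \<tau>)"
      if "M \<ge> M0" for \<tau> M
      using that by blast
    from eventually_small eventually_small_error[OF e, of "real M0 * (G + \<bar>v - e\<bar>)"]
    have "\<forall>\<^sub>F lam in at_right 0. matrix_val (W g q k lam z') \<ge> 0"
    proof eventually_elim
      case (elim lam)
      then have lam: "0 \<le> lam" "lam \<le> 1" by auto
      obtain x y u where eq: "\<And>l j. u l \<le> (\<Sum>i\<in>UNIV. pmf (x l) i *
            (lam * g l i j + (1 - lam) * (\<Sum>l'\<in>UNIV. pmf (q l i j) l' * u l')))"
          "\<And>l i. u l \<ge> (\<Sum>j\<in>UNIV. pmf (y l) j *
            (lam * g l i j + (1 - lam) * (\<Sum>l'\<in>UNIV. pmf (q l i j) l' * u l')))"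
          "\<And>l. \<bar>u l\<bar> \<le> G"
        by (rule discounted_equilibrium[where q = q, OF lam G]) (rule that)
      have "v - e - lam * (real M0 * (G + \<bar>v - e\<bar>)) \<le> u k"
        using elim by (intro stationary_reply_ge[OF _ _ eq(3,2) \<sigma>]) auto
      then have "z' \<le> u k" using elim by (simp add: e_def field_simps)
      then have "0 \<le> (u k - z') * lam ^ CARD('k)" using elim by simp
      moreover have "0 \<le> matrix_val (W g q k lam (u k))"
        by (rule matrix_val_W_nonneg[OF _ _ eq(1)]) (use elim in auto)
      ultimately show ?case
        using matrix_val_W_decreasing[of lam z' "u k"] lam \<open>z' \<le> u k\<close>by linarith
    qed
    then show ?thesis using F_nonneg F_pos_if_nonneg_right[OF zz'] by blast
  qed
  show "F g q k z < 0" if "z > v"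
  proof -
    define z' where "z' = (z + v) / 2"
    define e where "e = (z' - v) / 2"
    have e: "e > 0" and zz': "z' < z" using that by (auto simp: e_def z'_def)
    obtain M0 \<tau> where "\<forall>\<sigma>. (\<forall>M\<ge>M0.
          (\<integral>\<omega>. avg_reward g M \<omega> \<partial>play_measure q k \<sigma> \<tau>) \<le> v + e) \<and>
        (\<integral>\<omega>. limsup_reward g \<omega> \<partial>play_measure q k \<sigma> \<tau>) \<le> v + e"
      using v[unfolded is_game_value_def, rule_format, OF e] by (elim exE conjE)
    then have \<tau>: "(\<integral>\<omega>. avg_reward g M \<omega> \<partial>play_measure q k \<sigma> \<tau>) \<le> v + e"
      if "M \<ge> M0" for \<sigma> M
      using that by blast
    from eventually_small eventually_small_error[OF e, of "real M0 * (G + \<bar>v + e\<bar>)"]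
    have "\<forall>\<^sub>F lam in at_right 0. matrix_val (W g q k lam z') \<le> 0"
    proof eventually_elim
      case (elim lam)
      then have lam: "0 \<le> lam" "lam \<le> 1" by auto
      obtain x y u where eq: "\<And>l j. u l \<le> (\<Sum>i\<in>UNIV. pmf (x l) i *
            (lam * g l i j + (1 - lam) * (\<Sum>l'\<in>UNIV. pmf (q l i j) l' * u l')))"
          "\<And>l i. u l \<ge> (\<Sum>j\<in>UNIV. pmf (y l) j *
            (lam * g l i j + (1 - lam) * (\<Sum>l'\<in>UNIV. pmf (q l i j) l' * u l')))"
          "\<And>l. \<bar>u l\<bar> \<le> G"
        by (rule discounted_equilibrium[where q = q, OF lam G]) (rule that)
      have "u k \<le> v + e + lam * (real M0 * (G + \<bar>v + e\<bar>))"
        using elim by (intro stationary_reply_le[OF _ _ eq(3,1) \<tau>]) auto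
      then have "u k \<le> z'" using elim by (simp add: e_def field_simps)
      then have "0 \<le> (z' - u k) * lam ^ CARD('k)" using elim by simp
      moreover have "matrix_val (W g q k lam (u k)) \<le> 0"
        by (rule matrix_val_W_nonpos[OF _ _ eq(2)]) (use elim in auto)
      ultimately show ?case
        using matrix_val_W_decreasing[of lam "u k" z'] lam \<open>u k \<le> z'\<close>by linarith
    qed
    then show ?thesis using F_nonpos F_neg_if_nonpos_left[OF zz'] by blast
  qed
qed

end

theorem theorem2:
  fixes g :: "('k::finite, 'i::finite, 'j::finite) reward"
    and q :: "('k, 'i, 'j) transition"
    and k :: 'k
  shows "(\<forall>z. \<exists>L::ereal. (W_quot g q k z \<longlongrightarrow> L) (at_right 0)) \<and>
    (\<exists>!w::real. \<forall>z. (z > w \<longrightarrow> F g q k z < 0) \<and> (z < w \<longrightarrow> F g q k z > 0)) \<and>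
    (\<forall>v::real. is_game_value g q k v \<longrightarrow>
       (\<forall>w::real. (\<forall>z. (z > w \<longrightarrow> F g q k z < 0) \<and> (z < w \<longrightarrow> F g q k z > 0)) \<longleftrightarrow> w = v))"
proof (intro conjI allI impI)
  obtain G where G: "\<And>l i j. \<bar>g l i j\<bar> \<le> G"
    using reward_bounded[of g] by blast
  note unique = sign_change_unique[where g = g and q = q and k = k, OF G]
  show "\<exists>L::ereal. (W_quot g q k z \<longlongrightarrow> L) (at_right 0)" for z
    by (rule W_quot_converges)
  show "\<exists>!w::real. \<forall>z. (z > w \<longrightarrow> F g q k z < 0) \<and> (z < w \<longrightarrow> F g q k z > 0)"
    by (rule ex_ex1I) (rule sign_change_exists[OF G], rule unique)
  show "(\<forall>z. (z > w \<longrightarrow> F g q k z < 0) \<and> (z < w \<longrightarrow> F g q k z > 0)) \<longleftrightarrow> w = v"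
    if "is_game_value g q k v" for v w
    using sign_change_game_value[OF G that] unique by blast
qed

end
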